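(* Generalised geometric Cesàro convergence is scaling-invariant. That is, let $r\in\mathbb{R}_{>0}$, let $\gamma$ be a contour (a horizontal or vertical ray) and let $\tilde\gamma:=\gamma^{r}$. Let $f$ be a complex-valued function on $\tilde\gamma$ and let $g(z):=f(z^{r})$ for $z$ on $\gamma$. Then $g$ has a generalised Cesàro limit along $\gamma$ if and only if $f$ has a generalised Cesàro limit along $\tilde\gamma$, and in this case the two limits are equal (for every $L\in\mathbb{C}$, $g$ has generalised Cesàro limit $L$ along $\gamma$ if and only if $f$ has generalised Cesàro limit $L$ along $\tilde\gamma$).
   Context: A contour is a curve $\gamma:[0,\infty)\to\mathbb{C}$, $t\mapsto\gamma(t)$, parametrised by arc length $t$, starting at some $z_0\in\mathbb{C}$, with $\gamma(t)\to\infty$ as $t\to\infty$. The contours $\gamma$ considered are horizontal rays $\gamma(t)=z_0\pm t$ or vertical rays $\gamma(t)=z_0\pm it$, not meeting $0$ except possibly at the initial point. Fix a continuous branch of $\ln$ along $\gamma$ (away from $0$). The contour $\gamma^{r}$ is the curve with points $\gamma(t)^r=\exp(r\ln\gamma(t))$, re-parametrised by its own arc length, with the branch of the logarithm along $\gamma^r$ chosen so that $\ln(z^r)=r\ln z$ for $z$ on $\gamma$. Powers are $z^\rho=\exp(\rho\ln z)$ with these branches. Functions on a contour are regarded as functions along the curve (i.e. of its parameter). Generalised geometric Cesàro limit along a contour $\gamma$ (parametrised by arc length $t$; the same definition is applied to $\gamma^r$ with its own arc length): suppose that a function $f$ on $\gamma$ can be written as $$f(t)=\sum_{j=1}^{n}a_j\,(\gamma(t))^{\rho_j}\,(\ln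 \gamma(t))^{m_j}+R(t)$$ for some finite collection of constants $a_j\in\mathbb{C}$, $\rho_j\in\mathbb{C}\setminus\{0\}$, $m_j\in\mathbb{Z}_{\ge 0}$ and some remainder function $R$. If there exists $N\in\mathbb{Z}_{\ge0}$ such that $P^{N}[R](t)\to L$ classically as $t\to\infty$, where $P$ is the averaging operator in arc length along the contour, $$P[h](t)=\frac1t\int_0^t h(u)\,du,$$ then $f$ is said to have generalised Cesàro limit $L$ along the contour. Remainder functions are understood to be measurable and bounded on bounded intervals so that these averages make sense. *)

theory Defs
  imports "HOL-Analysis.Analysis"
begin

text \<open>
  Curves, and functions along curves, are total functions on the reals of which only the values
  at parameters \<open>t \<ge> 0\<close> are relevant.
\<close>

definition ray_contour :: "(real \<Rightarrow> complex) \<Rightarrow> bool" where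
  "ray_contour \<gamma> \<longleftrightarrow>
     (\<exists>z\<^sub>0. \<exists>d \<in> {1, -1, \<i>, -\<i>}. \<forall>t\<ge>0. \<gamma> t = z\<^sub>0 + complex_of_real t * d) \<and>
     (\<forall>t>0. \<gamma> t \<noteq> 0)"

definition log_branch :: "(real \<Rightarrow> complex) \<Rightarrow> (real \<Rightarrow> complex) \<Rightarrow> bool" where
  "log_branch \<gamma> l \<longleftrightarrow>
     continuous_on {t. 0 \<le> t \<and> \<gamma> t \<noteq> 0} l \<and>
     (\<forall>t\<ge>0. \<gamma> t \<noteq> 0 \<longrightarrow> exp (l t) = \<gamma> t)"

definition arc_length :: "(real \<Rightarrow> complex) \<Rightarrow> real \<Rightarrow> real" where
  "arc_length c t = integral {0..t} (\<lambda>u. norm (vector_derivative c (at u)))"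

text \<open>
  The curve \<open>t \<mapsto> \<gamma>(t)\<^sup>r\<close>, still in the parameter of \<open>\<gamma>\<close>, with powers formed by means of the
  branch \<open>l\<close> of the logarithm along \<open>\<gamma>\<close>, and \<open>0\<^sup>r = 0\<close>.
\<close>

definition powered_curve :: "(real \<Rightarrow> complex) \<Rightarrow> (real \<Rightarrow> complex) \<Rightarrow> real \<Rightarrow> real \<Rightarrow> complex" where
  "powered_curve \<gamma> l r t = (if \<gamma> t = 0 then 0 else exp (of_real r * l t))"

text \<open>
  \<open>power_length \<gamma> l r t\<close> is the arc length parameter on \<open>\<gamma>\<^sup>r\<close> of the point \<open>\<gamma>(t)\<^sup>r\<close>, and
  \<open>power_param \<gamma> l r\<close> is the inverse change of parameter.
\<close>

definition power_length :: "(real \<Rightarrow> complex) \<Rightarrow> (real \<Rightarrow> complex) \<Rightarrow> real \<Rightarrow> real \<Rightarrow> real" where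
  "power_length \<gamma> l r = arc_length (powered_curve \<gamma> l r)"

definition power_param :: "(real \<Rightarrow> complex) \<Rightarrow> (real \<Rightarrow> complex) \<Rightarrow> real \<Rightarrow> real \<Rightarrow> real" where
  "power_param \<gamma> l r = the_inv_into {0..} (power_length \<gamma> l r)"

definition power_contour :: "(real \<Rightarrow> complex) \<Rightarrow> (real \<Rightarrow> complex) \<Rightarrow> real \<Rightarrow> real \<Rightarrow> complex" where
  "power_contour \<gamma> l r s = powered_curve \<gamma> l r (power_param \<gamma> l r s)"

definition power_log :: "(real \<Rightarrow> complex) \<Rightarrow> (real \<Rightarrow> complex) \<Rightarrow> real \<Rightarrow> real \<Rightarrow> complex" where
  "power_log \<gamma> l r s = of_real r * l (power_param \<gamma> l r s)"

definition average :: "(real \<Rightarrow> complex) \<Rightarrow> real \<Rightarrow> complex" where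
  "average h t = integral {0..t} h / of_real t"

definition admissible_remainder :: "(real \<Rightarrow> complex) \<Rightarrow> bool" where
  "admissible_remainder R \<longleftrightarrow>
     R \<in> borel_measurable (lebesgue_on {0..}) \<and> (\<forall>T. bounded (R ` {0..T}))"

text \<open>
  In the following, \<open>\<gamma>\<close> is parametrised by arc length and \<open>l\<close> is the branch of the logarithm along
  it.  The decomposition is not required at an initial point \<open>\<gamma>(0) = 0\<close>, where its terms are
  undefined.
\<close>

definition has_gen_cesaro_limit ::
  "(real \<Rightarrow> complex) \<Rightarrow> (real \<Rightarrow> complex) \<Rightarrow> (real \<Rightarrow> complex) \<Rightarrow> complex \<Rightarrow> bool" where
  "has_gen_cesaro_limit \<gamma> l f L \<longleftrightarrow>
     (\<exists>(n::nat) (a::nat \<Rightarrow> complex) (\<rho>::nat \<Rightarrow> complex) (m::nat \<Rightarrow> nat) R.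
        (\<forall>j\<in>{1..n}. \<rho> j \<noteq> 0) \<and>
        admissible_remainder R \<and>
        (\<forall>t\<ge>0. \<gamma> t \<noteq> 0 \<longrightarrow>
           f t = (\<Sum>j=1..n. a j * exp (\<rho> j * l t) * l t ^ m j) + R t) \<and>
        (\<exists>N::nat. ((average ^^ N) R \<longlongrightarrow> L) at_top))"

end

theory Submission
  imports Defs "HOL-Real_Asymp.Real_Asymp"
begin

text \<open>
  Let \<open>t\<close> be the arc length along \<open>\<gamma>\<close> and \<open>s = \<sigma>(t)\<close> the arc length along \<open>\<gamma>\<^sup>r\<close>, with inverse
  \<open>t = \<tau>(s)\<close>. Since \<open>ln (z\<^sup>r) = r ln z\<close>, a term \<open>z^\<rho> (ln z)^m\<close> along one curve is a constant multiple
  of such a term along the other, so decompositions correspond to one another and a remainder \<open>R\<close>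
  along \<open>\<gamma>\<close> becomes \<open>R o \<tau>\<close> along \<open>\<gamma>\<^sup>r\<close>. It remains to show that \<open>P^N R \<longlongrightarrow> L\<close> in the scale \<open>t\<close> if and
  only if \<open>P^N (R o \<tau>) \<longlongrightarrow> L\<close> in the scale \<open>s\<close>, and this holds even with the same \<open>N\<close>.

  For a ray that starts at the origin \<open>s = t\<^sup>r\<close>. With the Euler operator \<open>D = t d/dt\<close> the two averages are
  \<open>P = (1 + D)^(-1)\<close> and \<open>Q = (1 + D / r)^(-1)\<close>; they commute, and \<open>Q = (r + (1 - r) Q) P\<close> shows that \<open>Q\<close>
  is obtained from \<open>P\<close> by an operation that preserves limits. For other rays \<open>r\<close> is replaced by the
  elasticity \<open>\<kappa> = t \<sigma>' / \<sigma>\<close>, and the identity becomes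
  \<open>Q = (\<kappa> - Q \<theta>) P\<close> with \<open>\<theta> = t \<sigma>'' / \<sigma>'\<close>, an integration by parts (\<open>average_compose\<close>). Now
  \<open>\<kappa>\<close> and \<open>\<theta>\<close> are functions that do not commute with averaging, but they converge at infinity, as do
  all their images under powers of \<open>D\<close>. For such a multiplier \<open>\<psi>\<close> the rule
  \<open>P \<psi> = \<psi> P - P (D \<psi>) P\<close> shows by induction that \<open>P^N h \<longlongrightarrow> L\<close> implies \<open>P^N (\<psi> h) \<longlongrightarrow> c L\<close>, where \<open>c\<close> is
  the limit of \<open>\<psi>\<close> (\<open>iterated_average_multiplier\<close>). Together these facts transfer iterated averages
  from one scale to the other (\<open>iterated_average_compose\<close>). Exchanging \<open>\<sigma>\<close> and \<open>\<tau>\<close>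
  replaces \<open>\<kappa>\<close> by \<open>1 / \<kappa>\<close>, so the argument is symmetric.

  For rays, \<open>\<kappa>\<close>, \<open>1 / \<kappa>\<close> and two bounded rational functions of \<open>t\<close> generate an algebra closed
  under \<open>D\<close>, and boundedness and convergence of the generators are elementary
  (\<open>ray_length.slow_algebra\<close>). That \<open>\<kappa>\<close> tends to \<open>r\<close> is l'Hopital's rule.
\<close>

section \<open>Averages of admissible functions\<close>

lemma norm_integral_le_length:
  fixes f :: "real \<Rightarrow> complex"
  assumes "(f has_integral i) {x..y}" "x \<le> y" "\<And>v. v \<in> {x..y} \<Longrightarrow> norm (f v) \<le> B"
  shows "norm i \<le> B * (y - x)"
proof -
  have "B \<ge> 0"
    by (rule order_trans [OF norm_ge_zero assms(3) [of x]]) (use assms(2) in simp)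
  then have "norm i \<le> B * measure lborel (cbox x y)"
    using assms by (intro has_integral_bound [of B f]) auto
  then show ?thesis
    using assms(2) by simp
qed

lemma average_nonpos [simp]: "t \<le> 0 \<Longrightarrow> average h t = 0"
  by (cases "t = 0") (simp_all add: average_def)

text \<open>
A single point does not affect an integral. Identities that fail at \<open>0\<close>, such as those that divide
by \<open>t\<close>, can therefore be used inside averages.
\<close>

lemma average_cong:
  assumes "\<And>t. t > 0 \<Longrightarrow> h t = k t"
  shows "average h = average k"
proof
  fix t :: real
  have "integral {0..t} h = integral {0..t} k"
  proof (rule integral_spike)
    show "negligible {0::real}"
      by simp
    show "k x = h x" if "x \<in> {0..t} - {0}" for x
      using assms [of x] that by simp
  qed
  then show "average h t = average k t"
    by (simp add: average_def)
qed

lemma iterated_average_tendsto_cong: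
  assumes "\<And>t. t > 0 \<Longrightarrow> h t = k t"
  shows "((average ^^ N) h \<longlongrightarrow> L) at_top \<longleftrightarrow> ((average ^^ N) k \<longlongrightarrow> L) at_top"
proof (cases N)
  case 0
  have "\<forall>\<^sub>F t in at_top. h t = k t"
    using eventually_gt_at_top [of 0] by eventually_elim (use assms in auto)
  with 0 show ?thesis
    by (simp add: tendsto_cong)
next
  case (Suc M)
  then show ?thesis
    using average_cong [OF assms] by (simp add: funpow_swap1)
qed

lemma admissible_bound:
  assumes "admissible_remainder h"
  obtains B where "B > 0" "\<And>t. t \<in> {0..T} \<Longrightarrow> norm (h t) \<le> B"
proof -
  have "bounded (h ` {0..T})"
    using assms by (simp add: admissible_remainder_def)
  then show ?thesis
    using that unfolding bounded_pos by auto
qed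

lemma admissible_absolutely_integrable:
  assumes h: "admissible_remainder h" and S: "S \<subseteq> {0..T}" "S \<in> sets lebesgue"
  shows "h absolutely_integrable_on S"
proof -
  obtain B where B: "\<And>t. t \<in> {0..T} \<Longrightarrow> norm (h t) \<le> B"
    using admissible_bound [OF h] by blast
  have "h \<in> borel_measurable (lebesgue_on S)"
    by (rule measurable_restrict_mono [of _ _ "{0..}"])
       (use h S in \<open>auto simp: admissible_remainder_def\<close>)
  moreover have "S \<in> lmeasurable"
    using S bounded_subset [OF bounded_closed_interval S(1)] by (simp add: bounded_set_imp_lmeasurable)
  ultimately show ?thesis
    by (intro measurable_bounded_by_integrable_imp_absolutely_integrable [where g = "\<lambda>_. B"])
       (use B S in \<open>auto intro: integrable_on_const\<close>)
qed

lemma admissible_integrable: "admissible_remainder h \<Longrightarrow> h integrable_on {0..T}"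
  by (rule set_lebesgue_integral_eq_integral(1) [OF admissible_absolutely_integrable [of h "{0..T}" T]]) auto

text \<open>
An average is continuous away from \<open>0\<close>, but \<open>0\<close> itself may be a jump, so continuity can be
required on the open half-line only. Measurability then survives by gluing in the value at \<open>0\<close>.
\<close>

lemma admissible_if_continuous:
  assumes "continuous_on {0<..} h" and "\<And>T. bounded (h ` {0<..T})"
  shows "admissible_remainder h"
proof -
  have "h \<in> borel_measurable (lebesgue_on {0<..})"
    by (intro continuous_imp_measurable_on_sets_lebesgue assms) auto
  then have "(\<lambda>t. if t \<in> {0<..} then h t else 0) \<in> borel_measurable lebesgue"
    using borel_measurable_if [of "{0<..}" h] by simp
  moreover have "(\<lambda>t. if t \<in> {0} then h 0 else 0) \<in> borel_measurable lebesgue"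
    by (rule borel_measurable_if_I) auto
  ultimately have "(\<lambda>t. (if t \<in> {0<..} then h t else 0) + (if t \<in> {0} then h 0 else 0)) \<in> borel_measurable lebesgue"
    by (rule borel_measurable_add)
  then have "(\<lambda>t. if t \<in> {0..} then h t else 0) \<in> borel_measurable lebesgue"
    by (rule back_subst [where P = "\<lambda>f. f \<in> borel_measurable lebesgue"]) auto
  moreover have "bounded (h ` {0..T})" for T
    by (rule bounded_subset [of "insert (h 0) (h ` {0<..T})"]) (use assms in \<open>auto simp: image_iff less_le\<close>)
  ultimately show ?thesis
    using borel_measurable_if [of "{0..}" h] by (simp add: admissible_remainder_def)
qed

lemma continuous_average:
  assumes "admissible_remainder h"
  shows "continuous_on {0<..} (average h)"
proof (rule continuous_at_imp_continuous_on, rule ballI)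
  fix x :: real assume "x \<in> {0<..}"
  then have "continuous_on {0..x+1} (\<lambda>t. integral {0..t} h)" "x > 0"
    using indefinite_integral_continuous_1 admissible_integrable [OF assms] by auto
  then have "isCont (\<lambda>t. integral {0..t} h) x"
    by (intro continuous_on_interior) auto
  then show "isCont (average h) x"
    using \<open>x > 0\<close> unfolding average_def [abs_def] by (intro continuous_intros) auto
qed

lemma norm_average_le:
  assumes "admissible_remainder h" and "\<And>u. u \<in> {0..t} \<Longrightarrow> norm (h u) \<le> B" and "0 \<le> B"
  shows "norm (average h t) \<le> B"
proof (cases "t > 0")
  case True
  have "norm (integral {0..t} h) \<le> B * (t - 0)"
    by (rule norm_integral_le_length [OF integrable_integral [OF admissible_integrable]])
       (use assms True in simp_all)
  with True show ?thesis
    by (simp add: average_def norm_divide field_simps)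
qed (use assms in auto)

lemma admissible_average:
  assumes "admissible_remainder h"
  shows "admissible_remainder (average h)"
proof (rule admissible_if_continuous [OF continuous_average [OF assms]])
  fix T :: real
  obtain B where "B > 0" "\<And>t. t \<in> {0..T} \<Longrightarrow> norm (h t) \<le> B"
    using admissible_bound [OF assms] by blast
  then show "bounded (average h ` {0<..T})"
    unfolding bounded_iff using norm_average_le [OF assms, of _ B]
    by (intro exI [of _ B]) force
qed

lemma admissible_iterated_average:
  "admissible_remainder h \<Longrightarrow> admissible_remainder ((average ^^ N) h)"
  by (induction N) (simp_all add: admissible_average)

lemma admissible_diff: "admissible_remainder h \<Longrightarrow> admissible_remainder k \<Longrightarrow> admissible_remainder (\<lambda>t. h t - k t)"
  unfolding admissible_remainder_def by (auto intro: bounded_minus_comp)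

lemma admissible_const: "admissible_remainder (\<lambda>_. c)"
  by (rule admissible_if_continuous) (auto simp: bounded_iff)

lemma average_diff:
  assumes "admissible_remainder h" "admissible_remainder k"
  shows "average (\<lambda>t. h t - k t) = (\<lambda>t. average h t - average k t)"
  using assms
  by (auto simp: average_def integral_diff admissible_integrable diff_divide_distrib)

lemma iterated_average_diff:
  assumes "admissible_remainder h" "admissible_remainder k"
  shows "(average ^^ N) (\<lambda>t. h t - k t) = (\<lambda>t. (average ^^ N) h t - (average ^^ N) k t)"
  using assms
proof (induction N arbitrary: h k)
  case (Suc N)
  then show ?case
    by (simp add: funpow_Suc_right average_diff admissible_average del: funpow.simps)
qed auto

lemma average_const: "t > 0 \<Longrightarrow> average (\<lambda>_. c) t = c"
  by (simp add: average_def scaleR_conv_of_real)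

text \<open>
Averaging is regular: it preserves a classical limit, because the initial stretch on which the
function is far from its limit contributes \<open>O(1/t)\<close>.
\<close>

lemma average_tendsto:
  assumes h: "admissible_remainder h" and lim: "(h \<longlongrightarrow> L) at_top"
  shows "(average h \<longlongrightarrow> L) at_top"
proof (rule tendstoI)
  fix e :: real assume "e > 0"
  define k where "k = (\<lambda>t. h t - L)"
  have k: "admissible_remainder k"
    unfolding k_def by (intro admissible_diff h admissible_const)
  have int: "k integrable_on {x..y}" if "0 \<le> x" for x y
    using integrable_subinterval_real [OF admissible_integrable [OF k, of y]] that by simp
  obtain T where T: "\<And>t. t \<ge> T \<Longrightarrow> norm (k t) \<le> e/2" "T > 0"
  proof -
    have "\<forall>\<^sub>F t in at_top. dist (h t) L < e/2"
      by (rule tendstoD [OF lim]) (use \<open>e > 0\<close> in simp)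
    then obtain M where M: "\<And>t. t \<ge> M \<Longrightarrow> dist (h t) L < e/2"
      unfolding eventually_at_top_linorder by blast
    show ?thesis
      by (rule that [of "max M 1"]) (use M in \<open>auto simp: k_def dist_norm less_imp_le\<close>)
  qed
  define C where "C = norm (integral {0..T} k)"
  have "\<forall>\<^sub>F t in at_top. t > max T (2 * C / e)"
    by (rule eventually_gt_at_top)
  then show "\<forall>\<^sub>F t in at_top. dist (average h t) L < e"
  proof eventually_elim
    case (elim t)
    then have t: "t > T" "t > 0" "C < e/2 * t"
      using T(2) \<open>e > 0\<close> by (auto simp: field_simps)
    have "integral {0..t} k = integral {0..T} k + integral {T..t} k"
      using t T(2) int [of 0 t] by (simp add: Henstock_Kurzweil_Integration.integral_combine)
    moreover have "norm (integral {T..t} k) \<le> e/2 * (t - T)"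
      by (rule norm_integral_le_length [OF integrable_integral [OF int]]) (use T t in simp_all)
    ultimately have "norm (integral {0..t} k) \<le> C + e/2 * (t - T)"
      using t norm_triangle_ineq [of "integral {0..T} k" "integral {T..t} k"] by (simp add: C_def)
    also have "\<dots> < e * t"
      using t mult_pos_pos [OF \<open>e > 0\<close> T(2)] by (simp add: field_simps)
    finally have "norm (average k t) < e"
      using t by (simp add: average_def norm_divide field_simps)
    moreover have "average k t = average h t - L"
      using t unfolding k_def by (simp add: average_diff h admissible_const average_const)
    ultimately show ?case
      by (simp add: dist_norm)
  qed
qed

section \<open>Integration by parts for bounded measurable functions\<close>

text \<open>
Here \<open>h\<close> is merely measurable and bounded, so its indefinite integral \<open>I\<close> need not be
differentiable at every point and the fundamental theorem of calculus does not apply to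
\<open>\<psi> I\<close>. Instead, let \<open>G\<close> be the difference of the two sides of the formula on \<open>{a..x}\<close>. Both
\<open>\<integral>(\<psi> v - \<psi> x) h v dv\<close> and \<open>\<integral>\<psi>' v (I v - I y) dv\<close> over \<open>{x..y}\<close> are \<open>O((y - x)\<^sup>2)\<close>, since
\<open>\<psi>\<close> and \<open>I\<close> are Lipschitz; hence so is \<open>G y - G x\<close>, and \<open>G\<close> is constant.
\<close>

lemma integral_by_parts_bounded:
  fixes h I :: "real \<Rightarrow> complex" and \<psi> \<psi>' :: "real \<Rightarrow> real"
  assumes "a \<le> b"
    and h: "h absolutely_integrable_on {a..b}" "\<And>x. x \<in> {a..b} \<Longrightarrow> norm (h x) \<le> B"
    and I: "\<And>x y. a \<le> x \<Longrightarrow> x \<le> y \<Longrightarrow> y \<le> b \<Longrightarrow> I y - I x = integral {x..y} h"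
    and \<psi>: "\<And>x. x \<in> {a..b} \<Longrightarrow> (\<psi> has_real_derivative \<psi>' x) (at x within {a..b})"
    and \<psi>': "continuous_on {a..b} \<psi>'"
  shows "integral {a..b} (\<lambda>x. \<psi> x *\<^sub>R h x)
         = \<psi> b *\<^sub>R I b - \<psi> a *\<^sub>R I a - integral {a..b} (\<lambda>x. \<psi>' x *\<^sub>R I x)"
proof -
  obtain C where C: "\<And>x. x \<in> {a..b} \<Longrightarrow> \<bar>\<psi>' x\<bar> \<le> C" "C > 0"
  proof -
    have "bounded (\<psi>' ` {a..b})"
      by (intro compact_imp_bounded compact_continuous_image \<psi>') auto
    then show ?thesis
      using that unfolding bounded_pos by force
  qed
  have \<psi>_cont: "continuous_on {a..b} \<psi>"
    using \<psi> by (intro DERIV_continuous_on)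
  have h_int: "h integrable_on {x..y}" if "a \<le> x" "y \<le> b" for x y
    using integrable_subinterval_real [OF set_lebesgue_integral_eq_integral(1) [OF h(1)]] that by simp
  have I_diff: "norm (I y - I x) \<le> B * (y - x)" if "a \<le> x" "x \<le> y" "y \<le> b" for x y
    unfolding I [OF that]
    by (rule norm_integral_le_length [OF integrable_integral [OF h_int]]) (use that h(2) in auto)
  have I_cont: "continuous_on {a..b} I"
  proof (rule continuous_on_eq)
    show "continuous_on {a..b} (\<lambda>x. I a + integral {a..x} h)"
      by (intro continuous_on_add continuous_on_const indefinite_integral_continuous_1 h_int) auto
    show "I a + integral {a..x} h = I x" if "x \<in> {a..b}" for x
      using I [of a x] that by (simp add: algebra_simps)
  qed
  have "(\<lambda>x. \<psi> x *\<^sub>R h x) absolutely_integrable_on {a..b}"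
  proof (rule absolutely_integrable_bounded_measurable_product [where h = scaleR])
    show "bilinear (scaleR :: real \<Rightarrow> complex \<Rightarrow> complex)"
      by (simp add: bilinear_conv_bounded_bilinear bounded_bilinear_scaleR)
    show "\<psi> \<in> borel_measurable (lebesgue_on {a..b})"
      by (rule continuous_imp_measurable_on_sets_lebesgue [OF \<psi>_cont]) simp
    show "bounded (\<psi> ` {a..b})"
      by (intro compact_imp_bounded compact_continuous_image \<psi>_cont) simp
  qed (use h in simp_all)
  then have int: "(\<lambda>x. \<psi> x *\<^sub>R h x) integrable_on {a..b}"
    by (rule set_lebesgue_integral_eq_integral(1))
  have int': "(\<lambda>x. \<psi>' x *\<^sub>R I x) integrable_on {a..b}"
    by (intro integrable_continuous_interval continuous_intros \<psi>' I_cont)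
  define G where "G x = integral {a..x} (\<lambda>x. \<psi> x *\<^sub>R h x) - \<psi> x *\<^sub>R I x
                        + integral {a..x} (\<lambda>x. \<psi>' x *\<^sub>R I x)" for x
  have \<psi>_diff: "\<bar>\<psi> v - \<psi> x\<bar> \<le> C * \<bar>v - x\<bar>" if "x \<in> {a..b}" "v \<in> {a..b}" for x v
    using field_differentiable_bound [of "{a..b}" \<psi> \<psi>' C v x] that \<psi> C by auto
  have G_diff: "norm (G y - G x) \<le> 2 * B * C * (y - x)\<^sup>2" if xy: "a \<le> x" "x \<le> y" "y \<le> b" for x y
  proof -
    have sub: "{x..y} \<subseteq> {a..b}"
      using xy by auto
    have 1: "integral {a..y} f - integral {a..x} f = integral {x..y} f"
      if "f integrable_on {a..b}" for f :: "real \<Rightarrow> complex"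
      using Henstock_Kurzweil_Integration.integral_combine [of a x y f] xy
        integrable_subinterval_real [OF that, of a y] by (auto simp: algebra_simps)
    have i1: "(\<lambda>v. \<psi> v *\<^sub>R h v) integrable_on {x..y}" and i2: "(\<lambda>v. \<psi>' v *\<^sub>R I v) integrable_on {x..y}"
      and i3: "h integrable_on {x..y}"
      using integrable_subinterval_real [OF int sub] integrable_subinterval_real [OF int' sub]
        h_int [of x y] xy by auto
    have ftc: "(\<psi>' has_integral (\<psi> y - \<psi> x)) {x..y}"
    proof (rule fundamental_theorem_of_calculus [OF xy(2)])
      show "(\<psi> has_vector_derivative \<psi>' v) (at v within {x..y})" if "v \<in> {x..y}" for v
        unfolding has_real_derivative_iff_has_vector_derivative [symmetric]
        by (rule DERIV_subset [OF \<psi> sub]) (use that sub in auto)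
    qed
    have "((\<lambda>v. \<psi> v *\<^sub>R h v - \<psi> x *\<^sub>R h v) has_integral
           (integral {x..y} (\<lambda>v. \<psi> v *\<^sub>R h v) - \<psi> x *\<^sub>R (I y - I x))) {x..y}"
      using xy i1 i3 by (auto simp: I intro!: has_integral_diff has_integral_cmul integrable_integral)
    then have n1: "norm (integral {x..y} (\<lambda>v. \<psi> v *\<^sub>R h v) - \<psi> x *\<^sub>R (I y - I x))
          \<le> C * (y - x) * B * (y - x)"
    proof (rule norm_integral_le_length [OF _ xy(2)])
      fix v assume v: "v \<in> {x..y}"
      have "norm (\<psi> v *\<^sub>R h v - \<psi> x *\<^sub>R h v) = \<bar>\<psi> v - \<psi> x\<bar> * norm (h v)"
        by (simp flip: scaleR_diff_left)
      also have "\<dots> \<le> (C * (y - x)) * B"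
      proof (rule mult_mono)
        show "\<bar>\<psi> v - \<psi> x\<bar> \<le> C * (y - x)"
          by (rule order_trans [OF \<psi>_diff]) (use v xy C(2) in auto)
      qed (use v xy C(2) h(2) in auto)
      finally show "norm (\<psi> v *\<^sub>R h v - \<psi> x *\<^sub>R h v) \<le> C * (y - x) * B" .
    qed
    have "((\<lambda>v. \<psi>' v *\<^sub>R I v - \<psi>' v *\<^sub>R I y) has_integral
           (integral {x..y} (\<lambda>v. \<psi>' v *\<^sub>R I v) - (\<psi> y - \<psi> x) *\<^sub>R I y)) {x..y}"
      using ftc i2 by (intro has_integral_diff has_integral_scaleR_left integrable_integral)
    then have n2: "norm (integral {x..y} (\<lambda>v. \<psi>' v *\<^sub>R I v) - (\<psi> y - \<psi> x) *\<^sub>R I y)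
          \<le> C * (B * (y - x)) * (y - x)"
    proof (rule norm_integral_le_length [OF _ xy(2)])
      fix v assume v: "v \<in> {x..y}"
      have "norm (\<psi>' v *\<^sub>R I v - \<psi>' v *\<^sub>R I y) = \<bar>\<psi>' v\<bar> * norm (I y - I v)"
        by (simp add: norm_minus_commute flip: scaleR_diff_right)
      also have "\<dots> \<le> C * (B * (y - x))"
      proof (rule mult_mono)
        have "B \<ge> 0"
          by (rule order_trans [OF norm_ge_zero h(2) [of a]]) (simp add: \<open>a \<le> b\<close>)
        then have "B * (y - v) \<le> B * (y - x)"
          using v by (intro mult_left_mono) auto
        then show "norm (I y - I v) \<le> B * (y - x)"
          using I_diff [of v y] v xy by auto
      qed (use v xy C in auto)
      finally show "norm (\<psi>' v *\<^sub>R I v - \<psi>' v *\<^sub>R I y) \<le> C * (B * (y - x))" .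
    qed
    have G: "G y - G x = (integral {x..y} (\<lambda>v. \<psi> v *\<^sub>R h v) - \<psi> x *\<^sub>R (I y - I x))
        + (integral {x..y} (\<lambda>v. \<psi>' v *\<^sub>R I v) - (\<psi> y - \<psi> x) *\<^sub>R I y)"
      using 1 [OF int] 1 [OF int'] by (simp add: G_def algebra_simps)
    have "norm (G y - G x) \<le> C * (y - x) * B * (y - x) + C * (B * (y - x)) * (y - x)"
      unfolding G by (rule order_trans [OF norm_triangle_ineq add_mono [OF n1 n2]])
    then show ?thesis
      by (simp add: power2_eq_square algebra_simps)
  qed
  have "(G has_derivative (\<lambda>_. 0)) (at x within {a..b})" if x: "x \<in> {a..b}" for x
  proof -
    have "norm (G y - G x) \<le> 2 * B * C * norm (y - x) ^ 2" if "y \<in> {a..b}" for y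
      using G_diff [of x y] G_diff [of y x] that x
      by (cases "x \<le> y") (auto simp: norm_minus_commute power2_commute)
    then have quot: "norm (G y - G x) / norm (y - x) \<le> 2 * B * C * norm (y - x)" if "y \<in> {a..b}" "y \<noteq> x" for y
      using that by (simp add: pos_divide_le_eq power2_eq_square mult.assoc del: real_norm_def)
    show ?thesis
    proof (rule has_derivativeI_sandwich [of 1])
      show "((\<lambda>y. 2 * B * C * norm (y - x)) \<longlongrightarrow> 0) (at x within {a..b})"
        by (rule tendsto_eq_intros refl | simp)+
    qed (use quot in auto)
  qed
  then have "G a = G b"
    using \<open>a \<le> b\<close> by (intro has_derivative_zero_unique [of "{a..b}"]) auto
  then show ?thesis
    by (simp add: G_def algebra_simps)
qed

section \<open>Slowly varying multipliers\<close>

text \<open>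
The weight \<open>\<psi>\<close> and its derivative may blow up at \<open>0\<close> (as \<open>t powr (r - 1)\<close> does for \<open>r < 1\<close>), so the lower
end of the interval is approached in the limit.
\<close>

lemma integral_by_parts_admissible:
  fixes \<psi> \<psi>' :: "real \<Rightarrow> real"
  assumes T: "T > 0" and h: "admissible_remainder h"
    and \<psi>: "\<And>t. t > 0 \<Longrightarrow> (\<psi> has_real_derivative \<psi>' t) (at t)"
    and \<psi>': "continuous_on {0<..} \<psi>'"
    and boundary: "((\<lambda>t. \<psi> t *\<^sub>R integral {0..t} h) \<longlongrightarrow> 0) (at_right 0)"
    and int: "(\<lambda>t. \<psi> t *\<^sub>R h t) integrable_on {0..T}"
    and int': "(\<lambda>t. \<psi>' t *\<^sub>R integral {0..t} h) integrable_on {0..T}"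
  shows "integral {0..T} (\<lambda>t. \<psi> t *\<^sub>R h t)
         = \<psi> T *\<^sub>R integral {0..T} h - integral {0..T} (\<lambda>t. \<psi>' t *\<^sub>R integral {0..t} h)"
proof -
  define I where "I t = integral {0..t} h" for t
  obtain B where B: "\<And>t. t \<in> {0..T} \<Longrightarrow> norm (h t) \<le> B"
    using admissible_bound [OF h] by metis
  have eq: "integral {e..T} (\<lambda>t. \<psi> t *\<^sub>R h t)
          = \<psi> T *\<^sub>R I T - \<psi> e *\<^sub>R I e - integral {e..T} (\<lambda>t. \<psi>' t *\<^sub>R I t)" if e: "0 < e" "e < T" for e
  proof (rule integral_by_parts_bounded)
    show "h absolutely_integrable_on {e..T}"
      by (rule admissible_absolutely_integrable [OF h, of _ T]) (use e in auto)
    show "I y - I x = integral {x..y} h" if "e \<le> x" "x \<le> y" "y \<le> T" for x y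
      using Henstock_Kurzweil_Integration.integral_combine [of 0 x y h] admissible_integrable [OF h, of y] that e
      by (simp add: I_def algebra_simps)
    show "(\<psi> has_real_derivative \<psi>' x) (at x within {e..T})" if "x \<in> {e..T}" for x
      by (rule has_field_derivative_at_within [OF \<psi>]) (use that e in auto)
    show "continuous_on {e..T} \<psi>'"
      by (rule continuous_on_subset [OF \<psi>']) (use e in auto)
    show "norm (h x) \<le> B" if "x \<in> {e..T}" for x
      by (rule B) (use that e in auto)
  qed (use e in auto)
  have lim: "((\<lambda>e. integral {e..T} f) \<longlongrightarrow> integral {0..T} f) (at_right 0)"
    if "f integrable_on {0..T}" for f :: "real \<Rightarrow> complex"
  proof -
    have "((\<lambda>e. integral {e..T} f) \<longlongrightarrow> integral {0..T} f) (at 0 within {0..T})"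
      using indefinite_integral_continuous_1' [OF that] T by (simp add: continuous_on)
    then show ?thesis
      using T by (simp add: at_within_Icc_at_right)
  qed
  have "((\<lambda>e. \<psi> T *\<^sub>R I T - \<psi> e *\<^sub>R I e - integral {e..T} (\<lambda>t. \<psi>' t *\<^sub>R I t))
          \<longlongrightarrow> \<psi> T *\<^sub>R I T - 0 - integral {0..T} (\<lambda>t. \<psi>' t *\<^sub>R I t)) (at_right 0)"
    unfolding I_def by (intro tendsto_diff tendsto_const boundary lim int')
  moreover have "\<forall>\<^sub>F e in at_right 0. \<psi> T *\<^sub>R I T - \<psi> e *\<^sub>R I e - integral {e..T} (\<lambda>t. \<psi>' t *\<^sub>R I t)
                    = integral {e..T} (\<lambda>t. \<psi> t *\<^sub>R h t)"
    using eventually_at_right_less [of 0] eventually_at_right_real [OF T]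
    by eventually_elim (use eq in auto)
  ultimately have "((\<lambda>e. integral {e..T} (\<lambda>t. \<psi> t *\<^sub>R h t))
          \<longlongrightarrow> \<psi> T *\<^sub>R I T - 0 - integral {0..T} (\<lambda>t. \<psi>' t *\<^sub>R I t)) (at_right 0)"
    by (rule Lim_transform_eventually)
  from tendsto_unique [OF _ lim [OF int] this] show ?thesis
    by (simp add: I_def)
qed

text \<open>
The multipliers for which averaging can be commuted with multiplication: they are bounded,
converge at infinity and stay in the class under the Euler operator \<open>\<psi> \<mapsto> (\<lambda>t. t \<psi>'(t))\<close>, so that
arbitrarily many integrations by parts are possible. The derivative is written \<open>\<psi>' t / t\<close> to make
\<open>\<psi>'\<close> the image of \<open>\<psi>\<close> under the Euler operator.
\<close>

definition slow_algebra :: "(real \<Rightarrow> real) set \<Rightarrow> bool" where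
  "slow_algebra S \<longleftrightarrow>
     (\<forall>c. (\<lambda>_. c) \<in> S) \<and>
     (\<forall>\<psi>\<in>S. \<forall>\<phi>\<in>S. (\<lambda>t. \<psi> t + \<phi> t) \<in> S \<and> (\<lambda>t. \<psi> t * \<phi> t) \<in> S) \<and>
     (\<forall>\<psi>\<in>S. bounded (\<psi> ` {0<..}) \<and> (\<exists>c. (\<psi> \<longlongrightarrow> c) at_top) \<and>
        (\<exists>\<psi>'\<in>S. \<forall>t>0. (\<psi> has_real_derivative \<psi>' t / t) (at t)))"

lemma slow_algebra_const: "slow_algebra S \<Longrightarrow> (\<lambda>_. c) \<in> S"
  and slow_algebra_add: "slow_algebra S \<Longrightarrow> \<psi> \<in> S \<Longrightarrow> \<phi> \<in> S \<Longrightarrow> (\<lambda>t. \<psi> t + \<phi> t) \<in> S"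
  and slow_algebra_mult: "slow_algebra S \<Longrightarrow> \<psi> \<in> S \<Longrightarrow> \<phi> \<in> S \<Longrightarrow> (\<lambda>t. \<psi> t * \<phi> t) \<in> S"
  by (simp_all add: slow_algebra_def)

lemma slow_algebra_derivative:
  assumes "slow_algebra S" "\<psi> \<in> S"
  obtains \<psi>' where "\<psi>' \<in> S" "\<And>t. t > 0 \<Longrightarrow> (\<psi> has_real_derivative \<psi>' t / t) (at t)"
  using assms unfolding slow_algebra_def by metis

lemma slow_algebra_bound:
  assumes "slow_algebra S" "\<psi> \<in> S"
  obtains C where "\<And>t. t > 0 \<Longrightarrow> \<bar>\<psi> t\<bar> \<le> C"
proof -
  have "bounded (\<psi> ` {0<..})"
    using assms by (simp add: slow_algebra_def)
  then show ?thesis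
    using that unfolding bounded_iff by auto
qed

lemma slow_algebra_limit:
  assumes "slow_algebra S" "\<psi> \<in> S"
  obtains c where "(\<psi> \<longlongrightarrow> c) at_top"
  using assms unfolding slow_algebra_def by metis

lemma slow_algebra_continuous:
  assumes "slow_algebra S" "\<psi> \<in> S"
  shows "continuous_on {0<..} \<psi>"
proof -
  obtain \<psi>' where "\<And>t. t > 0 \<Longrightarrow> (\<psi> has_real_derivative \<psi>' t / t) (at t)"
    using slow_algebra_derivative [OF assms] by metis
  then show ?thesis
    by (meson DERIV_isCont continuous_at_imp_continuous_on greaterThan_iff)
qed

lemma admissible_multiplier:
  assumes "slow_algebra S" "\<psi> \<in> S" "admissible_remainder h"
  shows "admissible_remainder (\<lambda>t. \<psi> t *\<^sub>R h t)"
proof -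
  obtain C where C: "\<And>t. t > 0 \<Longrightarrow> \<bar>\<psi> t\<bar> \<le> C"
    using slow_algebra_bound [OF assms(1,2)] by metis
  have "admissible_remainder (\<lambda>t. complex_of_real (\<psi> t))"
  proof (rule admissible_if_continuous)
    show "continuous_on {0<..} (\<lambda>t. complex_of_real (\<psi> t))"
      by (intro continuous_intros slow_algebra_continuous [OF assms(1,2)])
    show "bounded ((\<lambda>t. complex_of_real (\<psi> t)) ` {0<..T})" for T
      unfolding bounded_iff by (rule exI [of _ C]) (use C in auto)
  qed
  moreover have "bounded ((\<lambda>t. f t * g t) ` A)" if f: "bounded (f ` A)" and g: "bounded (g ` A)"
    for f g :: "real \<Rightarrow> complex" and A
  proof -
    obtain C D where "\<And>x. x \<in> A \<Longrightarrow> norm (f x) \<le> C" "\<And>x. x \<in> A \<Longrightarrow> norm (g x) \<le> D"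
      using f g unfolding bounded_iff by auto
    then have "norm (f x * g x) \<le> C * D" if "x \<in> A" for x
      unfolding norm_mult by (intro mult_mono order_trans [OF norm_ge_zero]) (use that in auto)
    then show ?thesis
      unfolding bounded_iff by auto
  qed
  ultimately show ?thesis
    using assms(3) by (simp add: admissible_remainder_def scaleR_conv_of_real borel_measurable_times)
qed

text \<open>
The commutation rule. With \<open>D\<close> for the Euler operator and \<open>P\<close> for averaging it reads
\<open>P \<psi> = \<psi> P - P (D \<psi>) P\<close>, an integration by parts against the indefinite integral of \<open>h\<close>. Every
term on the right has one \<open>P\<close> acting first on \<open>h\<close>.
\<close>

lemma average_multiplier:
  assumes S: "slow_algebra S" "\<psi> \<in> S" "\<psi>' \<in> S"
    and \<psi>: "\<And>t. t > 0 \<Longrightarrow> (\<psi> has_real_derivative \<psi>' t / t) (at t)"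
    and h: "admissible_remainder h" and T: "T > 0"
  shows "average (\<lambda>t. \<psi> t *\<^sub>R h t) T
         = \<psi> T *\<^sub>R average h T - average (\<lambda>t. \<psi>' t *\<^sub>R average h t) T"
proof -
  have I: "(\<psi>' t / t) *\<^sub>R integral {0..t} h = \<psi>' t *\<^sub>R average h t" if "t \<noteq> 0" for t
    using that by (simp add: average_def scaleR_conv_of_real)
  have int: "(\<lambda>t. \<psi>' t *\<^sub>R average h t) integrable_on {0..T}"
    by (intro admissible_integrable admissible_multiplier [OF S(1,3)] admissible_average h)
  have eq: "integral {0..T} (\<lambda>t. (\<psi>' t / t) *\<^sub>R integral {0..t} h) = integral {0..T} (\<lambda>t. \<psi>' t *\<^sub>R average h t)"
    by (rule integral_spike [of "{0}"]) (simp_all add: I)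
  have "integral {0..T} (\<lambda>t. \<psi> t *\<^sub>R h t)
        = \<psi> T *\<^sub>R integral {0..T} h - integral {0..T} (\<lambda>t. (\<psi>' t / t) *\<^sub>R integral {0..t} h)"
  proof (rule integral_by_parts_admissible [OF T h \<psi>])
    show "continuous_on {0<..} (\<lambda>t. \<psi>' t / t)"
      by (intro continuous_intros slow_algebra_continuous [OF S(1,3)]) auto
    show "(\<lambda>t. \<psi> t *\<^sub>R h t) integrable_on {0..T}"
      by (intro admissible_integrable admissible_multiplier [OF S(1,2)] h)
    show "(\<lambda>t. (\<psi>' t / t) *\<^sub>R integral {0..t} h) integrable_on {0..T}"
      by (rule integrable_spike [OF int, of "{0}"]) (simp_all add: I)
    have "((\<lambda>t. integral {0..t} h) \<longlongrightarrow> integral {0..0} h) (at 0 within {0..T})"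
      using bspec [OF indefinite_integral_continuous_1
          [OF admissible_integrable [OF h, of T], unfolded continuous_on], of 0] T by simp
    then have "((\<lambda>t. integral {0..t} h) \<longlongrightarrow> 0) (at_right 0)"
      using T by (simp add: at_within_Icc_at_right)
    moreover have "Bfun \<psi> (at_right 0)"
    proof -
      obtain C where C: "\<And>t. t > 0 \<Longrightarrow> \<bar>\<psi> t\<bar> \<le> C"
        using slow_algebra_bound [OF S(1,2)] by metis
      show ?thesis
        by (rule BfunI [of _ C]) (use C in \<open>auto simp: eventually_at_filter\<close>)
    qed
    ultimately show "((\<lambda>t. \<psi> t *\<^sub>R integral {0..t} h) \<longlongrightarrow> 0) (at_right 0)"
      by (auto simp: tendsto_Zfun_iff intro: bounded_bilinear.Bfun_prod_Zfun [OF bounded_bilinear_scaleR])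
  qed auto
  then show ?thesis
    using T by (simp add: eq average_def diff_divide_distrib scaleR_conv_of_real)
qed

text \<open>
If \<open>t \<psi>'(t)\<close> tended to a nonzero limit, \<open>\<psi>\<close> would grow like a logarithm. Formally, the commutation
rule for the constant function \<open>1\<close> is \<open>P \<psi> = \<psi> - P (D \<psi>)\<close>; by regularity both \<open>P \<psi>\<close> and \<open>\<psi>\<close> tend
to the same limit.
\<close>

lemma slow_algebra_derivative_tendsto_0:
  assumes S: "slow_algebra S" "\<psi> \<in> S" "\<psi>' \<in> S"
    and \<psi>: "\<And>t. t > 0 \<Longrightarrow> (\<psi> has_real_derivative \<psi>' t / t) (at t)"
  shows "(\<psi>' \<longlongrightarrow> 0) at_top"
proof -
  obtain c c' where lim: "(\<psi> \<longlongrightarrow> c) at_top" "(\<psi>' \<longlongrightarrow> c') at_top"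
    using slow_algebra_limit S by metis
  have adm: "admissible_remainder (\<lambda>t. f t *\<^sub>R 1)" if "f \<in> S" for f
    using admissible_multiplier [OF S(1) that admissible_const [of 1]] .
  have avg: "(average (\<lambda>t. f t *\<^sub>R 1) \<longlongrightarrow> of_real d) at_top" if "f \<in> S" "(f \<longlongrightarrow> d) at_top" for f d
    by (rule average_tendsto [OF adm]) (use that in \<open>auto simp: scaleR_conv_of_real intro: tendsto_of_real\<close>)
  have "\<forall>\<^sub>F t in at_top. \<psi> t *\<^sub>R 1 - average (\<lambda>t. \<psi>' t *\<^sub>R 1) t = average (\<lambda>t. \<psi> t *\<^sub>R 1) t"
    using eventually_gt_at_top [of 0]
  proof eventually_elim
    case (elim t)
    have "average (\<lambda>t. \<psi>' t *\<^sub>R average (\<lambda>_. 1) t) = average (\<lambda>t. \<psi>' t *\<^sub>R 1)"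
      by (rule average_cong) (simp add: average_const)
    then show ?case
      using average_multiplier [OF S \<psi> admissible_const [of 1] elim] elim by (simp add: average_const)
  qed
  moreover have "((\<lambda>t. \<psi> t *\<^sub>R 1 - average (\<lambda>t. \<psi>' t *\<^sub>R 1) t) \<longlongrightarrow> of_real c - of_real c') at_top"
    by (intro tendsto_diff avg S lim) (use lim in \<open>auto simp: scaleR_conv_of_real intro: tendsto_of_real\<close>)
  ultimately have "(average (\<lambda>t. \<psi> t *\<^sub>R 1) \<longlongrightarrow> of_real c - of_real c') at_top"
    by (rule Lim_transform_eventually [rotated])
  from tendsto_unique [OF _ avg [OF S(2) lim(1)] this] have "c' = 0"
    by simp
  with lim show ?thesis
    by simp
qed

text \<open>
By the commutation rule, \<open>P^(N+1) (\<psi> h)\<close> is \<open>P^N\<close> of \<open>\<psi> (P h)\<close> minus \<open>P^(N+1)\<close> of \<open>(D \<psi>) (P h)\<close>. The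
induction hypothesis, used once for \<open>\<psi>\<close> and once for \<open>D \<psi>\<close>, gives \<open>c L\<close> for the former and \<open>0\<close>
for the latter.
\<close>

lemma iterated_average_multiplier:
  assumes S: "slow_algebra S" "\<psi> \<in> S" and c: "(\<psi> \<longlongrightarrow> c) at_top"
    and h: "admissible_remainder h" and lim: "((average ^^ N) h \<longlongrightarrow> L) at_top"
  shows "((average ^^ N) (\<lambda>t. \<psi> t *\<^sub>R h t) \<longlongrightarrow> c *\<^sub>R L) at_top"
  using S(2) c h lim
proof (induction N arbitrary: \<psi> c h)
  case 0
  then show ?case
    by (auto intro: tendsto_scaleR)
next
  case (Suc N)
  obtain \<psi>' where \<psi>': "\<psi>' \<in> S" and deriv: "\<And>t. t > 0 \<Longrightarrow> (\<psi> has_real_derivative \<psi>' t / t) (at t)"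
    using slow_algebra_derivative [OF S(1) Suc.prems(1)] by metis
  define H where "H = average h"
  have H: "admissible_remainder H" "((average ^^ N) H \<longlongrightarrow> L) at_top"
    using Suc.prems by (simp_all add: H_def admissible_average funpow_Suc_right del: funpow.simps)
  have adm: "admissible_remainder (\<lambda>t. f t *\<^sub>R H t)" if "f \<in> S" for f
    by (rule admissible_multiplier [OF S(1) that H(1)])
  have "((average ^^ N) (\<lambda>t. \<psi> t *\<^sub>R H t) \<longlongrightarrow> c *\<^sub>R L) at_top"
    by (rule Suc.IH [OF Suc.prems(1,2) H])
  moreover have "((average ^^ N) (average (\<lambda>t. \<psi>' t *\<^sub>R H t)) \<longlongrightarrow> 0) at_top"
  proof -
    have "((average ^^ N) (\<lambda>t. \<psi>' t *\<^sub>R H t) \<longlongrightarrow> 0 *\<^sub>R L) at_top"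
      by (rule Suc.IH [OF \<psi>' slow_algebra_derivative_tendsto_0 [OF S(1) Suc.prems(1) \<psi>' deriv] H])
    moreover have "admissible_remainder ((average ^^ N) (\<lambda>t. \<psi>' t *\<^sub>R H t))"
      by (rule admissible_iterated_average [OF adm [OF \<psi>']])
    ultimately have "(average ((average ^^ N) (\<lambda>t. \<psi>' t *\<^sub>R H t)) \<longlongrightarrow> 0 *\<^sub>R L) at_top"
      by (intro average_tendsto)
    then show ?thesis
      by (simp add: funpow_swap1)
  qed
  ultimately have "((average ^^ N) (\<lambda>t. \<psi> t *\<^sub>R H t - average (\<lambda>t. \<psi>' t *\<^sub>R H t) t) \<longlongrightarrow> c *\<^sub>R L - 0) at_top"
    unfolding iterated_average_diff [OF adm [OF Suc.prems(1)] admissible_average [OF adm [OF \<psi>']]]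
    by (rule tendsto_diff)
  then have "((average ^^ N) (average (\<lambda>t. \<psi> t *\<^sub>R h t)) \<longlongrightarrow> c *\<^sub>R L - 0) at_top"
    by (subst (asm) iterated_average_tendsto_cong [of _ "average (\<lambda>t. \<psi> t *\<^sub>R h t)"])
       (simp_all add: H_def average_multiplier [OF S(1) Suc.prems(1) \<psi>' deriv Suc.prems(3)])
  then show ?case
    by (simp add: funpow_Suc_right del: funpow.simps)
qed

section \<open>Averages under a change of scale\<close>

locale scale_bijection =
  fixes \<sigma> \<tau> :: "real \<Rightarrow> real"
  assumes \<sigma>_mono: "strict_mono_on {0..} \<sigma>"
    and \<sigma>_nonneg: "\<And>t. t \<ge> 0 \<Longrightarrow> \<sigma> t \<ge> 0" and \<tau>_nonneg: "\<And>s. s \<ge> 0 \<Longrightarrow> \<tau> s \<ge> 0"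
    and \<sigma>_\<tau>: "\<And>s. s \<ge> 0 \<Longrightarrow> \<sigma> (\<tau> s) = s" and \<tau>_\<sigma>: "\<And>t. t \<ge> 0 \<Longrightarrow> \<tau> (\<sigma> t) = t"
begin

lemma \<sigma>_less_iff: "x \<ge> 0 \<Longrightarrow> y \<ge> 0 \<Longrightarrow> \<sigma> x < \<sigma> y \<longleftrightarrow> x < y"
  using \<sigma>_mono by (simp add: strict_mono_on_less)

lemma \<tau>_less_iff: "x \<ge> 0 \<Longrightarrow> y \<ge> 0 \<Longrightarrow> \<tau> x < \<tau> y \<longleftrightarrow> x < y"
  using \<sigma>_less_iff [of "\<tau> x" "\<tau> y"] by (simp add: \<tau>_nonneg \<sigma>_\<tau>)

lemma \<tau>_pos: "s > 0 \<Longrightarrow> \<tau> s > 0"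
  using \<tau>_less_iff [of 0 s] \<tau>_nonneg [of 0] by simp

lemma \<sigma>_pos: "t > 0 \<Longrightarrow> \<sigma> t > 0"
  using \<sigma>_less_iff [of 0 t] \<sigma>_nonneg [of 0] by simp

lemma \<sigma>_0 [simp]: "\<sigma> 0 = 0"
  using \<sigma>_less_iff [of "\<tau> 0" 0] \<sigma>_nonneg [of 0] \<tau>_nonneg [of 0] \<sigma>_\<tau> [of 0] by force

lemma image_interval: "\<sigma> ` {0<..<t} = {0<..<\<sigma> t}" if "t > 0"
proof
  show "\<sigma> ` {0<..<t} \<subseteq> {0<..<\<sigma> t}"
    using that by (auto simp: \<sigma>_pos \<sigma>_less_iff)
  show "{0<..<\<sigma> t} \<subseteq> \<sigma> ` {0<..<t}"
  proof
    fix s assume s: "s \<in> {0<..<\<sigma> t}"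
    then have "s = \<sigma> (\<tau> s)" "\<tau> s > 0" "\<tau> s < t"
      using \<sigma>_less_iff [of "\<tau> s" t] that by (auto simp: \<sigma>_\<tau> \<tau>_pos less_imp_le)
    then show "s \<in> \<sigma> ` {0<..<t}"
      by auto
  qed
qed

lemma filterlim_\<tau>: "filterlim \<tau> at_top at_top"
  unfolding filterlim_at_top_ge [where c = 0]
proof (intro allI impI)
  fix M :: real assume M: "M \<ge> 0"
  have "\<forall>\<^sub>F s in at_top. s \<ge> \<sigma> M \<and> s \<ge> 0"
    by (intro eventually_conj eventually_ge_at_top)
  then show "\<forall>\<^sub>F s in at_top. M \<le> \<tau> s"
  proof eventually_elim
    case (elim s)
    then show ?case
      using \<sigma>_less_iff [of "\<tau> s" M] M \<tau>_nonneg [of s] \<sigma>_\<tau> [of s] by (cases "\<tau> s < M") auto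
  qed
qed

lemma \<sigma>_tendsto_0: "(\<sigma> \<longlongrightarrow> 0) (at_right 0)"
proof (rule tendstoI)
  fix e :: real assume "e > 0"
  then have "\<forall>\<^sub>F t in at_right 0. t \<in> {0<..<\<tau> e}"
    by (intro eventually_at_right_real \<tau>_pos)
  then show "\<forall>\<^sub>F t in at_right 0. dist (\<sigma> t) 0 < e"
  proof eventually_elim
    case (elim t)
    then show ?case
      using \<sigma>_less_iff [of t "\<tau> e"] \<open>e > 0\<close> \<sigma>_pos [of t] by (simp add: \<sigma>_\<tau>)
  qed
qed

lemma scale_bijection_inverse: "scale_bijection \<tau> \<sigma>"
  by unfold_locales (auto simp: strict_mono_on_def \<tau>_less_iff \<sigma>_nonneg \<tau>_nonneg \<sigma>_\<tau> \<tau>_\<sigma>)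

end

text \<open>
Two arc length parameters \<open>t\<close> and \<open>s = \<sigma> t\<close>. What makes averages in the two scales comparable is
the elasticity \<open>\<kappa> = t \<sigma>'(t) / \<sigma>(t)\<close>, considered as a function of \<open>s\<close>: membership in a slow algebra
means that \<open>\<sigma>\<close> behaves like a power of \<open>t\<close> up to corrections that are again slow.
\<close>

locale change_of_scale = scale_bijection +
  fixes S :: "(real \<Rightarrow> real) set" and \<kappa> :: "real \<Rightarrow> real"
  assumes slow: "slow_algebra S" and \<kappa>: "\<kappa> \<in> S" and \<kappa>_pos: "\<And>s. s > 0 \<Longrightarrow> \<kappa> s > 0"
    and deriv: "\<And>t. t > 0 \<Longrightarrow> (\<sigma> has_real_derivative \<kappa> (\<sigma> t) * \<sigma> t / t) (at t)"
begin

text \<open>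
The point is measurability. The preimage of a set under \<open>\<tau>\<close> is its image under the
differentiable map \<open>\<sigma>\<close>, and differentiable images of Lebesgue sets are Lebesgue sets; \<open>\<sigma>\<close> may
fail to be differentiable at \<open>0\<close>, so that point is split off.
\<close>

lemma admissible_compose:
  assumes k: "admissible_remainder k"
  shows "admissible_remainder (\<lambda>s. k (\<tau> s))"
  unfolding admissible_remainder_def
proof
  have preimage: "{s \<in> {0..}. k (\<tau> s) \<in> B} = \<sigma> ` ({t \<in> {0..}. k t \<in> B} \<inter> {0<..}) \<union> (if k (\<tau> 0) \<in> B then {0} else {})"
    for B
  proof (intro equalityI subsetI)
    fix s assume "s \<in> {s \<in> {0..}. k (\<tau> s) \<in> B}"
    then show "s \<in> \<sigma> ` ({t \<in> {0..}. k t \<in> B} \<inter> {0<..}) \<union> (if k (\<tau> 0) \<in> B then {0} else {})"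
      using \<tau>_pos [of s] \<sigma>_\<tau> [of s] by (cases "s = 0") (auto intro!: image_eqI [of s \<sigma> "\<tau> s"])
  next
    fix s assume "s \<in> \<sigma> ` ({t \<in> {0..}. k t \<in> B} \<inter> {0<..}) \<union> (if k (\<tau> 0) \<in> B then {0} else {})"
    then show "s \<in> {s \<in> {0..}. k (\<tau> s) \<in> B}"
      by (auto simp: \<sigma>_nonneg \<tau>_\<sigma> split: if_splits)
  qed
  have "\<sigma> ` (A \<inter> {0<..}) \<in> sets lebesgue" if "A \<in> sets lebesgue" for A
  proof (rule differentiable_image_in_sets_lebesgue)
    have "\<sigma> differentiable (at t within A \<inter> {0<..})" if "t > 0" for t
      unfolding real_differentiable_def
      using has_field_derivative_at_within [OF deriv [OF that]] by (rule exI)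
    then show "\<sigma> differentiable_on A \<inter> {0<..}"
      by (simp add: differentiable_on_def)
  qed (use that in auto)
  moreover have "{t \<in> {0..}. k t \<in> B} \<in> sets lebesgue" if "B \<in> sets borel" for B
    using k that unfolding admissible_remainder_def
    by (auto dest!: measurable_sets [OF _ that] simp: sets_restrict_space_iff space_restrict_space vimage_def Int_def conj_commute)
  ultimately have "{s \<in> {0..}. k (\<tau> s) \<in> B} \<in> sets lebesgue" if "B \<in> sets borel" for B
    unfolding preimage using that by (intro sets.Un) auto
  then show "(\<lambda>s. k (\<tau> s)) \<in> borel_measurable (lebesgue_on {0..})"
    by (intro measurableI) (auto simp: sets_restrict_space_iff space_restrict_space vimage_def Int_def conj_commute)
  show "\<forall>T. bounded ((\<lambda>s. k (\<tau> s)) ` {0..T})"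
  proof
    fix T :: real
    have "\<tau> ` {0..T} \<subseteq> {0..\<tau> T}"
    proof clarify
      fix s assume "s \<in> {0..T}"
      then show "\<tau> s \<in> {0..\<tau> T}"
        using \<tau>_less_iff [of T s] by (auto simp: \<tau>_nonneg)
    qed
    then have "(\<lambda>s. k (\<tau> s)) ` {0..T} \<subseteq> k ` {0..\<tau> T}"
      by blast
    then show "bounded ((\<lambda>s. k (\<tau> s)) ` {0..T})"
      by (rule bounded_subset [rotated]) (use k in \<open>simp add: admissible_remainder_def\<close>)
  qed
qed

lemma integral_substitution:
  assumes f: "admissible_remainder f" and t: "t > 0"
  shows "integral {0..\<sigma> t} f = integral {0..t} (\<lambda>u. (\<kappa> (\<sigma> u) * \<sigma> u / u) *\<^sub>R f (\<sigma> u))"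
    and "(\<lambda>u. (\<kappa> (\<sigma> u) * \<sigma> u / u) *\<^sub>R f (\<sigma> u)) integrable_on {0..t}"
proof -
  let ?d = "\<lambda>u. \<kappa> (\<sigma> u) * \<sigma> u / u"
  have "f absolutely_integrable_on {0<..<\<sigma> t}"
    by (rule admissible_absolutely_integrable [OF f, of _ "\<sigma> t"]) auto
  then have *: "(\<lambda>u. \<bar>?d u\<bar> *\<^sub>R f (\<sigma> u)) absolutely_integrable_on {0<..<t} \<and>
      integral {0<..<t} (\<lambda>u. \<bar>?d u\<bar> *\<^sub>R f (\<sigma> u)) = integral {0<..<\<sigma> t} f"
    unfolding image_interval [OF t, symmetric]
  proof (subst has_absolute_integral_change_of_variables_real)
    show "(\<sigma> has_field_derivative ?d u) (at u within {0<..<t})" if "u \<in> {0<..<t}" for u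
      by (rule has_field_derivative_at_within [OF deriv]) (use that in simp)
    show "inj_on \<sigma> {0<..<t}"
      by (rule inj_on_inverseI [of _ \<tau>]) (simp add: \<tau>_\<sigma>)
  qed simp_all
  have pos: "\<bar>?d u\<bar> = ?d u" if "u \<in> {0<..<t}" for u
    using \<kappa>_pos [OF \<sigma>_pos [of u]] \<sigma>_pos [of u] that by simp
  have "(\<lambda>u. ?d u *\<^sub>R f (\<sigma> u)) integrable_on {0<..<t} \<longleftrightarrow> (\<lambda>u. \<bar>?d u\<bar> *\<^sub>R f (\<sigma> u)) integrable_on {0<..<t}"
    by (rule integrable_cong) (simp only: pos)
  then show "(\<lambda>u. ?d u *\<^sub>R f (\<sigma> u)) integrable_on {0..t}"
    using * set_lebesgue_integral_eq_integral(1) integrable_on_open_interval_real by blast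
  have "integral {0<..<t} (\<lambda>u. \<bar>?d u\<bar> *\<^sub>R f (\<sigma> u)) = integral {0<..<t} (\<lambda>u. ?d u *\<^sub>R f (\<sigma> u))"
    by (rule integral_cong) (simp only: pos)
  then show "integral {0..\<sigma> t} f = integral {0..t} (\<lambda>u. ?d u *\<^sub>R f (\<sigma> u))"
    using * by (simp add: integral_open_interval_real)
qed

text \<open>
One average in the scale \<open>s\<close> is expressed through the average of \<open>k\<close> in the scale \<open>t\<close>. Substitution turns
\<open>\<integral> k (\<tau> s) ds\<close> into \<open>\<integral> \<sigma>'(t) k(t) dt\<close>, and integration by parts moves \<open>\<sigma>'\<close> off \<open>k\<close>. As
\<open>\<sigma>' = \<kappa> \<sigma> / t\<close>, the relative rate \<open>t \<sigma>'' / \<sigma>'\<close> is \<open>D \<kappa> + \<kappa> - 1\<close> with \<open>D\<close> the Euler operator in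
\<open>s\<close>, which is again slow; substituting back yields the second average.
\<close>

lemma average_compose:
  assumes k: "admissible_remainder k"
    and \<kappa>': "\<kappa>' \<in> S" "\<And>s. s > 0 \<Longrightarrow> (\<kappa> has_real_derivative \<kappa>' s / s) (at s)"
    and s: "s > 0"
  shows "average (\<lambda>s. k (\<tau> s)) s
         = \<kappa> s *\<^sub>R average k (\<tau> s) - average (\<lambda>s. (\<kappa>' s + \<kappa> s - 1) *\<^sub>R average k (\<tau> s)) s"
proof -
  define \<theta> where "\<theta> = (\<lambda>s. \<kappa>' s + \<kappa> s - 1)"
  have "(\<lambda>s. \<kappa>' s + \<kappa> s + (-1)) \<in> S"
    by (intro slow_algebra_add slow_algebra_const slow \<kappa> \<kappa>'(1))
  then have \<theta>: "\<theta> \<in> S"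
    by (simp add: \<theta>_def)
  define d where "d = (\<lambda>u. \<kappa> (\<sigma> u) * \<sigma> u / u)"
  define T where "T = \<tau> s"
  have T: "T > 0" "\<sigma> T = s"
    using s by (auto simp: T_def \<tau>_pos \<sigma>_\<tau>)
  \<comment> \<open>the density of the substitution satisfies \<open>t d'(t) = d(t) \<theta>(\<sigma> t)\<close>\<close>
  have d_deriv: "(d has_real_derivative d t * \<theta> (\<sigma> t) / t) (at t)" if "t > 0" for t
  proof -
    have pos: "\<sigma> t > 0"
      using that by (rule \<sigma>_pos)
    have "((\<lambda>u. \<kappa> (\<sigma> u)) has_real_derivative \<kappa>' (\<sigma> t) / \<sigma> t * d t) (at t)"
      unfolding d_def by (rule DERIV_chain2 [OF \<kappa>'(2) [OF pos] deriv [OF that]])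
    moreover have "(\<sigma> has_real_derivative d t) (at t)"
      unfolding d_def by (rule deriv [OF that])
    ultimately have quotient: "((\<lambda>u. \<kappa> (\<sigma> u) * \<sigma> u / u) has_real_derivative
        ((\<kappa>' (\<sigma> t) / \<sigma> t * d t * \<sigma> t + d t * \<kappa> (\<sigma> t)) * t - \<kappa> (\<sigma> t) * \<sigma> t * 1) / (t * t)) (at t)"
      using that by (intro DERIV_divide DERIV_mult DERIV_ident) auto
    have eq: "((\<kappa>' (\<sigma> t) / \<sigma> t * d t * \<sigma> t + d t * \<kappa> (\<sigma> t)) * t - \<kappa> (\<sigma> t) * \<sigma> t * 1) / (t * t)
        = d t * \<theta> (\<sigma> t) / t"
      using that pos by (simp add: d_def \<theta>_def field_simps)
    show ?thesis
      using quotient [unfolded eq, folded d_def] .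
  qed
  have cont: "continuous_on {0<..} (\<lambda>t. f (\<sigma> t))" if "f \<in> S" for f
  proof (rule continuous_on_compose2 [OF slow_algebra_continuous [OF slow that]])
    show "continuous_on {0<..} \<sigma>"
      using deriv by (intro DERIV_continuous_on [where D = d]) (auto simp: d_def intro: has_field_derivative_at_within)
  qed (auto simp: \<sigma>_pos)
  have k\<tau>: "admissible_remainder (\<lambda>s. k (\<tau> s))"
    by (rule admissible_compose [OF k])
  have G: "admissible_remainder (\<lambda>s. \<theta> s *\<^sub>R average k (\<tau> s))"
    by (intro admissible_multiplier [OF slow \<theta>] admissible_compose admissible_average k)
  have \<theta>I: "(d t * \<theta> (\<sigma> t) / t) *\<^sub>R integral {0..t} k = d t *\<^sub>R (\<theta> (\<sigma> t) *\<^sub>R average k (\<tau> (\<sigma> t)))"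
    if "t \<in> {0..T} - {0}" for t
    using that by (simp add: \<tau>_\<sigma> average_def scaleR_conv_of_real)
  have substitution: "integral {0..s} f = integral {0..T} (\<lambda>u. d u *\<^sub>R f (\<sigma> u))"
      "(\<lambda>u. d u *\<^sub>R f (\<sigma> u)) integrable_on {0..T}" if "admissible_remainder f" for f
    using integral_substitution [OF that T(1)] by (simp_all add: d_def T(2))
  have k_int: "integral {0..T} (\<lambda>t. d t *\<^sub>R k (\<tau> (\<sigma> t))) = integral {0..T} (\<lambda>t. d t *\<^sub>R k t)"
    by (rule integral_cong) (simp add: \<tau>_\<sigma>)
  have k_integrable: "(\<lambda>t. d t *\<^sub>R k (\<tau> (\<sigma> t))) integrable_on {0..T} \<longleftrightarrow> (\<lambda>t. d t *\<^sub>R k t) integrable_on {0..T}"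
    by (rule integrable_cong) (simp add: \<tau>_\<sigma>)
  have "integral {0..s} (\<lambda>s. k (\<tau> s)) = integral {0..T} (\<lambda>t. d t *\<^sub>R k t)"
    using substitution(1) [OF k\<tau>] by (simp only: k_int)
  also have "\<dots> = d T *\<^sub>R integral {0..T} k - integral {0..T} (\<lambda>t. (d t * \<theta> (\<sigma> t) / t) *\<^sub>R integral {0..t} k)"
  proof (rule integral_by_parts_admissible [OF T(1) k d_deriv])
    show "continuous_on {0<..} (\<lambda>t. d t * \<theta> (\<sigma> t) / t)"
      using d_deriv by (intro continuous_intros cont \<theta> DERIV_continuous_on [of _ d])
        (auto intro: has_field_derivative_at_within)
    show "(\<lambda>t. d t *\<^sub>R k t) integrable_on {0..T}"
      using substitution(2) [OF k\<tau>] by (simp only: k_integrable)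
    show "(\<lambda>t. (d t * \<theta> (\<sigma> t) / t) *\<^sub>R integral {0..t} k) integrable_on {0..T}"
      by (rule integrable_spike [OF substitution(2) [OF G], of "{0}"])
         (use \<theta>I in auto)
    \<comment> \<open>even if \<open>d\<close> blows up, \<open>t d(t) = \<kappa>(\<sigma> t) \<sigma>(t)\<close> tends to \<open>0\<close>, and the other factor is \<open>O(t)\<close>\<close>
    show "((\<lambda>t. d t *\<^sub>R integral {0..t} k) \<longlongrightarrow> 0) (at_right 0)"
    proof -
      obtain C where C: "\<And>s. s > 0 \<Longrightarrow> \<bar>\<kappa> s\<bar> \<le> C"
        using slow_algebra_bound [OF slow \<kappa>] by metis
      obtain B where B: "\<And>t. t \<in> {0..1} \<Longrightarrow> norm (average k t) \<le> B"
        using admissible_bound [OF admissible_average [OF k]] by metis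
      show ?thesis
      proof (rule Lim_null_comparison)
        show "\<forall>\<^sub>F t in at_right 0. norm (d t *\<^sub>R integral {0..t} k) \<le> C * \<sigma> t * B"
          using eventually_at_right_real [of 0 1, simplified]
        proof eventually_elim
          case (elim t)
          have "norm (d t *\<^sub>R integral {0..t} k) = \<bar>\<kappa> (\<sigma> t)\<bar> * \<sigma> t * norm (average k t)"
            using elim \<sigma>_pos [of t] by (simp add: d_def average_def norm_divide abs_mult)
          also have "\<dots> \<le> C * \<sigma> t * B"
            using elim C [OF \<sigma>_pos [of t]] B [of t] \<sigma>_pos [of t]
            by (intro mult_mono) (auto intro!: mult_nonneg_nonneg intro: order_trans [OF abs_ge_zero])
          finally show ?case .
        qed
        show "((\<lambda>t. C * \<sigma> t * B) \<longlongrightarrow> 0) (at_right 0)"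
          using tendsto_mult [OF tendsto_mult [OF tendsto_const \<sigma>_tendsto_0] tendsto_const, of C B] by simp
      qed
    qed
  qed
  also have "integral {0..T} (\<lambda>t. (d t * \<theta> (\<sigma> t) / t) *\<^sub>R integral {0..t} k)
      = integral {0..T} (\<lambda>t. d t *\<^sub>R (\<theta> (\<sigma> t) *\<^sub>R average k (\<tau> (\<sigma> t))))"
    by (rule integral_spike [of "{0}"]) (use \<theta>I in auto)
  also have "\<dots> = integral {0..s} (\<lambda>s. \<theta> s *\<^sub>R average k (\<tau> s))"
    using substitution(1) [OF G] by (rule sym)
  also have "d T *\<^sub>R integral {0..T} k = of_real s * (\<kappa> s *\<^sub>R average k (\<tau> s))"
    using T s by (simp add: d_def average_def scaleR_conv_of_real flip: T_def)
  finally show ?thesis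
    using s by (simp add: average_def [of _ s] diff_divide_distrib \<theta>_def scaleR_conv_of_real)
qed

text \<open>
The same number of averages suffices in both scales. Write \<open>Q\<close> for averaging in \<open>s\<close>. By the
previous formula \<open>Q^(N+1) (k o \<tau>)\<close> equals \<open>Q^N (\<kappa> H) - Q^(N+1) (\<theta> H)\<close> with \<open>H = (P k) o \<tau>\<close>; the
induction hypothesis gives \<open>Q^N H \<longlongrightarrow> L\<close>, the slow factors may be pulled out, and the limits \<open>c\<close> of
\<open>\<kappa>\<close> and \<open>c - 1\<close> of \<open>\<theta>\<close> differ by exactly \<open>1\<close>.
\<close>

lemma iterated_average_compose:
  assumes "admissible_remainder k" and "((average ^^ N) k \<longlongrightarrow> L) at_top"
  shows "((average ^^ N) (\<lambda>s. k (\<tau> s)) \<longlongrightarrow> L) at_top"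
  using assms
proof (induction N arbitrary: k)
  case 0
  then show ?case
    by (auto intro: filterlim_compose [OF _ filterlim_\<tau>])
next
  case (Suc N)
  obtain \<kappa>' where \<kappa>': "\<kappa>' \<in> S" "\<And>s. s > 0 \<Longrightarrow> (\<kappa> has_real_derivative \<kappa>' s / s) (at s)"
    using slow_algebra_derivative [OF slow \<kappa>] by metis
  define \<theta> where "\<theta> = (\<lambda>s. \<kappa>' s + \<kappa> s - 1)"
  have "(\<lambda>s. \<kappa>' s + \<kappa> s + (-1)) \<in> S"
    by (intro slow_algebra_add slow_algebra_const slow \<kappa> \<kappa>'(1))
  then have \<theta>: "\<theta> \<in> S"
    by (simp add: \<theta>_def)
  obtain c where c: "(\<kappa> \<longlongrightarrow> c) at_top"
    using slow_algebra_limit [OF slow \<kappa>] by metis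
  have \<theta>_lim: "(\<theta> \<longlongrightarrow> c - 1) at_top"
    using tendsto_diff [OF tendsto_add [OF slow_algebra_derivative_tendsto_0 [OF slow \<kappa> \<kappa>'] c] tendsto_const [of 1]]
    by (simp add: \<theta>_def)
  define H where "H = (\<lambda>s. average k (\<tau> s))"
  have H: "admissible_remainder H"
    unfolding H_def by (intro admissible_compose admissible_average Suc.prems)
  have H_lim: "((average ^^ N) H \<longlongrightarrow> L) at_top"
    unfolding H_def by (rule Suc.IH)
      (use Suc.prems in \<open>simp_all add: admissible_average funpow_Suc_right del: funpow.simps\<close>)
  have adm: "admissible_remainder (\<lambda>s. \<kappa> s *\<^sub>R H s)" "admissible_remainder (\<lambda>s. \<theta> s *\<^sub>R H s)"
    using admissible_multiplier [OF slow _ H] \<kappa> \<theta> by auto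
  have 1: "((average ^^ N) (\<lambda>s. \<kappa> s *\<^sub>R H s) \<longlongrightarrow> c *\<^sub>R L) at_top"
    by (rule iterated_average_multiplier [OF slow \<kappa> c H H_lim])
  have "((average ^^ N) (\<lambda>s. \<theta> s *\<^sub>R H s) \<longlongrightarrow> (c - 1) *\<^sub>R L) at_top"
    by (rule iterated_average_multiplier [OF slow \<theta> \<theta>_lim H H_lim])
  then have "(average ((average ^^ N) (\<lambda>s. \<theta> s *\<^sub>R H s)) \<longlongrightarrow> (c - 1) *\<^sub>R L) at_top"
    by (intro average_tendsto admissible_iterated_average adm)
  then have 2: "((average ^^ N) (average (\<lambda>s. \<theta> s *\<^sub>R H s)) \<longlongrightarrow> (c - 1) *\<^sub>R L) at_top"
    by (simp add: funpow_swap1)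
  have "((average ^^ N) (\<lambda>s. \<kappa> s *\<^sub>R H s - average (\<lambda>s. \<theta> s *\<^sub>R H s) s) \<longlongrightarrow> c *\<^sub>R L - (c - 1) *\<^sub>R L) at_top"
    unfolding iterated_average_diff [OF adm(1) admissible_average [OF adm(2)]]
    by (rule tendsto_diff [OF 1 2])
  then have "((average ^^ N) (average (\<lambda>s. k (\<tau> s))) \<longlongrightarrow> c *\<^sub>R L - (c - 1) *\<^sub>R L) at_top"
    by (subst (asm) iterated_average_tendsto_cong [of _ "average (\<lambda>s. k (\<tau> s))"])
       (simp_all add: average_compose [OF Suc.prems(1) \<kappa>'] H_def \<theta>_def)
  then show ?case
    by (simp add: funpow_Suc_right algebra_simps del: funpow.simps)
qed

end

section \<open>Both directions of a change of scale; generating slow algebras\<close>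

context scale_bijection
begin

text \<open>
Transport of a slow algebra to the other scale: the Euler operators differ by the factor \<open>\<phi>\<close>, the
elasticity of \<open>\<tau>\<close>, so it is enough that \<open>\<phi>\<close> is a member.
\<close>

lemma slow_algebra_compose:
  assumes S: "slow_algebra S" and \<phi>: "\<phi> \<in> S"
    and deriv: "\<And>s. s > 0 \<Longrightarrow> (\<tau> has_real_derivative \<phi> (\<tau> s) * \<tau> s / s) (at s)"
  shows "slow_algebra ((\<lambda>\<psi> s. \<psi> (\<tau> s)) ` S)"
  unfolding slow_algebra_def
proof (intro conjI allI ballI)
  show "(\<lambda>_. c) \<in> (\<lambda>\<psi> s. \<psi> (\<tau> s)) ` S" for c
    by (rule image_eqI [OF _ slow_algebra_const [OF S]]) simp
next
  fix f g assume "f \<in> (\<lambda>\<psi> s. \<psi> (\<tau> s)) ` S" "g \<in> (\<lambda>\<psi> s. \<psi> (\<tau> s)) ` S"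
  then obtain \<psi> \<omega> where fg: "f = (\<lambda>s. \<psi> (\<tau> s))" "g = (\<lambda>s. \<omega> (\<tau> s))" "\<psi> \<in> S" "\<omega> \<in> S"
    by auto
  show "(\<lambda>t. f t + g t) \<in> (\<lambda>\<psi> s. \<psi> (\<tau> s)) ` S"
    by (rule image_eqI [OF _ slow_algebra_add [OF S fg(3,4)]]) (simp add: fg)
  show "(\<lambda>t. f t * g t) \<in> (\<lambda>\<psi> s. \<psi> (\<tau> s)) ` S"
    by (rule image_eqI [OF _ slow_algebra_mult [OF S fg(3,4)]]) (simp add: fg)
next
  fix f assume "f \<in> (\<lambda>\<psi> s. \<psi> (\<tau> s)) ` S"
  then obtain \<psi> where f: "f = (\<lambda>s. \<psi> (\<tau> s))" and \<psi>: "\<psi> \<in> S"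
    by auto
  obtain C where "\<And>t. t > 0 \<Longrightarrow> \<bar>\<psi> t\<bar> \<le> C"
    using slow_algebra_bound [OF S \<psi>] by metis
  then show "bounded (f ` {0<..})"
    unfolding bounded_iff f by (intro exI [of _ C]) (auto simp: \<tau>_pos)
  obtain c where "(\<psi> \<longlongrightarrow> c) at_top"
    using slow_algebra_limit [OF S \<psi>] by metis
  then show "\<exists>c. (f \<longlongrightarrow> c) at_top"
    unfolding f by (intro exI filterlim_compose [OF _ filterlim_\<tau>])
  obtain \<psi>' where \<psi>': "\<psi>' \<in> S" "\<And>t. t > 0 \<Longrightarrow> (\<psi> has_real_derivative \<psi>' t / t) (at t)"
    using slow_algebra_derivative [OF S \<psi>] by metis
  have "(f has_real_derivative (\<psi>' (\<tau> s) * \<phi> (\<tau> s)) / s) (at s)" if s: "s > 0" for s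
  proof -
    have eq: "\<psi>' (\<tau> s) / \<tau> s * (\<phi> (\<tau> s) * \<tau> s / s) = (\<psi>' (\<tau> s) * \<phi> (\<tau> s)) / s"
      using \<tau>_pos [OF s] s by (simp add: field_simps)
    show ?thesis
      unfolding f by (rule DERIV_chain2 [OF \<psi>'(2) [OF \<tau>_pos [OF s]] deriv [OF s], unfolded eq])
  qed
  then show "\<exists>\<psi>'\<in>(\<lambda>\<psi> s. \<psi> (\<tau> s)) ` S. \<forall>t>0. (f has_real_derivative \<psi>' t / t) (at t)"
    by (intro bexI [OF _ imageI [OF slow_algebra_mult [OF S \<psi>'(1) \<phi>]]]) simp
qed

text \<open>
The elasticity of \<open>\<tau>\<close> is the reciprocal of that of \<open>\<sigma>\<close>. So a slow algebra in \<open>t\<close> that contains both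
\<open>\<kappa>\<close> and \<open>1 / \<kappa>\<close> makes the comparison of averages available in either direction.
\<close>

lemma change_of_scale_both_ways:
  assumes S: "slow_algebra S" and \<kappa>: "\<kappa> \<in> S" "(\<lambda>t. 1 / \<kappa> t) \<in> S" and \<kappa>_pos: "\<And>t. t > 0 \<Longrightarrow> \<kappa> t > 0"
    and deriv: "\<And>t. t > 0 \<Longrightarrow> (\<sigma> has_real_derivative \<kappa> t * \<sigma> t / t) (at t)"
  shows "change_of_scale \<sigma> \<tau> ((\<lambda>\<psi> s. \<psi> (\<tau> s)) ` S) (\<lambda>s. \<kappa> (\<tau> s))"
    and "change_of_scale \<tau> \<sigma> S (\<lambda>t. 1 / \<kappa> t)"
proof -
  have deriv_\<tau>: "(\<tau> has_real_derivative 1 / \<kappa> (\<tau> s) * \<tau> s / s) (at s)" if s: "s > 0" for s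
  proof -
    have pos: "z > 0" if "\<bar>z - \<tau> s\<bar> \<le> \<tau> s / 2" for z
      using that \<tau>_pos [OF s] by linarith
    have "isCont \<tau> (\<sigma> (\<tau> s))"
    proof (rule isCont_inverse_function [where f = \<sigma> and x = "\<tau> s" and d = "\<tau> s / 2"])
      show "\<tau> (\<sigma> z) = z" if "\<bar>z - \<tau> s\<bar> \<le> \<tau> s / 2" for z
        using pos [OF that] by (simp add: \<tau>_\<sigma>)
      show "isCont \<sigma> z" if "\<bar>z - \<tau> s\<bar> \<le> \<tau> s / 2" for z
        by (rule DERIV_isCont [OF deriv [OF pos [OF that]]])
    qed (use \<tau>_pos [OF s] in simp)
    then have "(\<tau> has_real_derivative inverse (\<kappa> (\<tau> s) * \<sigma> (\<tau> s) / \<tau> s)) (at s)"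
      using \<tau>_pos [OF s] \<kappa>_pos [of "\<tau> s"] s
      by (intro DERIV_inverse_function [where f = \<sigma> and a = 0 and b = "s + 1"] deriv) (auto simp: \<sigma>_\<tau>)
    moreover have "inverse (\<kappa> (\<tau> s) * \<sigma> (\<tau> s) / \<tau> s) = 1 / \<kappa> (\<tau> s) * \<tau> s / s"
      using s by (simp add: \<sigma>_\<tau> field_simps)
    ultimately show ?thesis
      by (simp only:)
  qed
  show "change_of_scale \<sigma> \<tau> ((\<lambda>\<psi> s. \<psi> (\<tau> s)) ` S) (\<lambda>s. \<kappa> (\<tau> s))"
  proof unfold_locales
    show "slow_algebra ((\<lambda>\<psi> s. \<psi> (\<tau> s)) ` S)"
      by (rule slow_algebra_compose [OF S \<kappa>(2) deriv_\<tau>])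
  qed (use \<kappa>(1) \<kappa>_pos \<tau>_pos deriv in \<open>auto simp: \<tau>_\<sigma>\<close>)
  show "change_of_scale \<tau> \<sigma> S (\<lambda>t. 1 / \<kappa> t)"
    by (intro change_of_scale.intro scale_bijection_inverse change_of_scale_axioms.intro S \<kappa>(2) deriv_\<tau>)
       (simp add: \<kappa>_pos)
qed

end

text \<open>
Sums and products preserve all the requirements on slow multipliers, so closure under the Euler
operator has to be checked on generators only.
\<close>

inductive_set generated_algebra :: "(real \<Rightarrow> real) set \<Rightarrow> (real \<Rightarrow> real) set" for X where
  generator: "\<psi> \<in> X \<Longrightarrow> \<psi> \<in> generated_algebra X"
| const: "(\<lambda>_. c) \<in> generated_algebra X"
| add: "\<psi> \<in> generated_algebra X \<Longrightarrow> \<phi> \<in> generated_algebra X \<Longrightarrow> (\<lambda>t. \<psi> t + \<phi> t) \<in> generated_algebra X"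
| mult: "\<psi> \<in> generated_algebra X \<Longrightarrow> \<phi> \<in> generated_algebra X \<Longrightarrow> (\<lambda>t. \<psi> t * \<phi> t) \<in> generated_algebra X"

lemma slow_algebra_generated:
  assumes "\<And>\<psi>. \<psi> \<in> X \<Longrightarrow> bounded (\<psi> ` {0<..})" "\<And>\<psi>. \<psi> \<in> X \<Longrightarrow> \<exists>c. (\<psi> \<longlongrightarrow> c) at_top"
    and "\<And>\<psi>. \<psi> \<in> X \<Longrightarrow> \<exists>\<psi>'\<in>generated_algebra X. \<forall>t>0. (\<psi> has_real_derivative \<psi>' t / t) (at t)"
  shows "slow_algebra (generated_algebra X)"
proof -
  have "bounded (\<psi> ` {0<..}) \<and> (\<exists>c. (\<psi> \<longlongrightarrow> c) at_top) \<and>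
        (\<exists>\<psi>'\<in>generated_algebra X. \<forall>t>0. (\<psi> has_real_derivative \<psi>' t / t) (at t))"
    if "\<psi> \<in> generated_algebra X" for \<psi>
    using that
  proof induction
    case (generator \<psi>)
    then show ?case
      using assms by blast
  next
    case (const c)
    have "\<exists>\<psi>'\<in>generated_algebra X. \<forall>t>0. ((\<lambda>_. c) has_real_derivative \<psi>' t / t) (at t)"
      by (rule bexI [OF _ generated_algebra.const [of 0]]) simp
    then show ?case
      by (auto simp: bounded_iff)
  next
    case (add \<psi> \<phi>)
    then obtain \<psi>' \<phi>' c d
      where in_alg: "\<psi>' \<in> generated_algebra X" "\<phi>' \<in> generated_algebra X"
      and deriv: "\<And>t. t > 0 \<Longrightarrow> (\<psi> has_real_derivative \<psi>' t / t) (at t)"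
        "\<And>t. t > 0 \<Longrightarrow> (\<phi> has_real_derivative \<phi>' t / t) (at t)"
      and lim: "(\<psi> \<longlongrightarrow> c) at_top" "(\<phi> \<longlongrightarrow> d) at_top"
      by blast
    have "((\<lambda>t. \<psi> t + \<phi> t) has_real_derivative (\<psi>' t + \<phi>' t) / t) (at t)" if "t > 0" for t
      using DERIV_add [OF deriv [OF that]] by (simp add: add_divide_distrib)
    moreover have "((\<lambda>t. \<psi> t + \<phi> t) \<longlongrightarrow> c + d) at_top"
      by (intro tendsto_add lim)
    moreover have "bounded ((\<lambda>t. \<psi> t + \<phi> t) ` {0<..})"
      using add by (intro bounded_plus_comp) auto
    ultimately show ?case
      by (intro conjI exI [of _ "c + d"] bexI [OF _ generated_algebra.add [OF in_alg]] allI impI)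
  next
    case (mult \<psi> \<phi>)
    then obtain \<psi>' \<phi>' c d
      where in_alg: "\<psi>' \<in> generated_algebra X" "\<phi>' \<in> generated_algebra X"
      and deriv: "\<And>t. t > 0 \<Longrightarrow> (\<psi> has_real_derivative \<psi>' t / t) (at t)"
        "\<And>t. t > 0 \<Longrightarrow> (\<phi> has_real_derivative \<phi>' t / t) (at t)"
      and lim: "(\<psi> \<longlongrightarrow> c) at_top" "(\<phi> \<longlongrightarrow> d) at_top"
      by blast
    have "((\<lambda>t. \<psi> t * \<phi> t) has_real_derivative (\<psi>' t * \<phi> t + \<phi>' t * \<psi> t) / t) (at t)" if "t > 0" for t
      using DERIV_mult [OF deriv [OF that]] by (simp add: add_divide_distrib)
    moreover have *: "(\<lambda>t. \<psi>' t * \<phi> t + \<phi>' t * \<psi> t) \<in> generated_algebra X"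
      by (intro generated_algebra.add generated_algebra.mult in_alg mult.hyps)
    moreover have "((\<lambda>t. \<psi> t * \<phi> t) \<longlongrightarrow> c * d) at_top"
      by (intro tendsto_mult lim)
    moreover have "bounded ((\<lambda>t. \<psi> t * \<phi> t) ` {0<..})"
    proof -
      obtain C D where "\<And>t. t > 0 \<Longrightarrow> \<bar>\<psi> t\<bar> \<le> C" "\<And>t. t > 0 \<Longrightarrow> \<bar>\<phi> t\<bar> \<le> D"
        using mult unfolding bounded_iff by auto
      then have "\<bar>\<psi> t * \<phi> t\<bar> \<le> C * D" if "t > 0" for t
        unfolding abs_mult by (intro mult_mono order_trans [OF abs_ge_zero]) (use that in auto)
      then show ?thesis
        unfolding bounded_iff by (intro exI [of _ "C * D"]) auto
    qed
    ultimately show ?case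
      by (intro conjI exI [of _ "c * d"] bexI [OF _ *] allI impI)
  qed
  then show ?thesis
    unfolding slow_algebra_def
    by (auto intro: generated_algebra.const generated_algebra.add generated_algebra.mult)
qed

lemma bounded_on_half_line:
  fixes f :: "real \<Rightarrow> real"
  assumes cont: "continuous_on {0<..} f" and lim: "(f \<longlongrightarrow> c) (at_right 0)" "(f \<longlongrightarrow> d) at_top"
  shows "bounded (f ` {0<..})"
proof -
  have "\<forall>\<^sub>F t in at_right 0. dist (f t) c < 1"
    by (rule tendstoD [OF lim(1)]) simp
  then obtain e where e: "e > 0" "\<And>t. 0 < t \<Longrightarrow> t < e \<Longrightarrow> dist (f t) c < 1"
    unfolding eventually_at_right_field by auto
  have "\<forall>\<^sub>F t in at_top. dist (f t) d < 1"
    by (rule tendstoD [OF lim(2)]) simp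
  then obtain M where M: "\<And>t. t \<ge> M \<Longrightarrow> dist (f t) d < 1"
    unfolding eventually_at_top_linorder by auto
  have "bounded (f ` {e..M})"
    by (intro compact_imp_bounded compact_continuous_image continuous_on_subset [OF cont])
       (use e(1) in auto)
  then have "bounded (f ` {e..M} \<union> cball c 1 \<union> cball d 1)"
    by simp
  moreover have "f t \<in> f ` {e..M} \<union> cball c 1 \<union> cball d 1" if "t > 0" for t
    using e(2) [OF that] M [of t] by (force simp: dist_commute)
  then have "f ` {0<..} \<subseteq> f ` {e..M} \<union> cball c 1 \<union> cball d 1"
    by (simp add: image_subset_iff)
  ultimately show ?thesis
    by (rule bounded_subset)
qed

section \<open>The length function of a power of a ray\<close>

text \<open>
After a rotation a ray is \<open>t \<mapsto> t + a + \<i> b\<close>, so \<open>(t + a)\<^sup>2 + b\<^sup>2\<close> is the squared distance from the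
origin, and the curve of \<open>r\<close>-th powers has speed \<open>r |\<gamma>| powr (r - 1)\<close> and length function \<open>\<sigma>\<close>.
\<close>

locale ray_length =
  fixes a b r :: real and \<sigma> :: "real \<Rightarrow> real"
  assumes r: "r > 0" and radius_pos: "\<And>t. t > 0 \<Longrightarrow> (t + a)\<^sup>2 + b\<^sup>2 > 0"
    and cont: "continuous_on {0..} \<sigma>" and \<sigma>_0: "\<sigma> 0 = 0"
    and deriv: "\<And>t. t > 0 \<Longrightarrow> (\<sigma> has_real_derivative r * ((t + a)\<^sup>2 + b\<^sup>2) powr ((r - 1) / 2)) (at t)"
begin

definition q :: "real \<Rightarrow> real" where "q t = (t + a)\<^sup>2 + b\<^sup>2"
definition speed :: "real \<Rightarrow> real" where "speed t = r * q t powr ((r - 1) / 2)"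
text \<open>
The functions \<open>x\<close> and \<open>y\<close> are chosen so that \<open>D x\<close> and \<open>D y\<close> are polynomials in \<open>x\<close> and \<open>y\<close>. The
factor \<open>a\<close> in \<open>x\<close> keeps \<open>x\<close> bounded when the ray starts at the origin: then \<open>a = 0\<close>, whereas
\<open>t / q t\<close> is unbounded.
\<close>

definition x :: "real \<Rightarrow> real" where "x t = a * t / q t"
definition y :: "real \<Rightarrow> real" where "y t = t\<^sup>2 / q t"
definition \<kappa> :: "real \<Rightarrow> real" where "\<kappa> t = t * speed t / \<sigma> t"

lemma q_pos: "t > 0 \<Longrightarrow> q t > 0"
  using radius_pos by (simp add: q_def)

lemma speed_pos: "t > 0 \<Longrightarrow> speed t > 0"
  using q_pos [of t] r by (simp add: speed_def)

lemma q_deriv: "(q has_real_derivative 2 * (t + a)) (at t)"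
  unfolding q_def by (auto intro!: derivative_eq_intros)

lemma \<sigma>_deriv: "t > 0 \<Longrightarrow> (\<sigma> has_real_derivative speed t) (at t)"
  using deriv by (simp add: speed_def q_def)

lemma speed_deriv: "t > 0 \<Longrightarrow> (speed has_real_derivative speed t * ((r - 1) * (x t + y t)) / t) (at t)"
proof -
  assume t: "t > 0"
  have "(speed has_real_derivative r * (((r - 1) / 2) * q t powr ((r - 1) / 2 - 1) * (2 * (t + a)))) (at t)"
    unfolding speed_def using q_pos [OF t]
    by (auto intro!: derivative_eq_intros q_deriv)
  moreover have "q t powr ((r - 1) / 2 - 1) = q t powr ((r - 1) / 2) / q t"
    using q_pos [OF t] by (simp add: powr_diff)
  moreover have "r * (((r - 1) / 2) * (p / q t) * (2 * (t + a))) = r * p * ((r - 1) * (x t + y t)) / t" for p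
    using t q_pos [OF t] by (simp add: x_def y_def field_simps power2_eq_square)
  ultimately show ?thesis
    by (simp add: speed_def)
qed

lemma strict_mono_\<sigma>: "strict_mono_on {0..} \<sigma>"
proof (rule strict_mono_onI)
  fix u t :: real assume ut: "u \<in> {0..}" "t \<in> {0..}" "u < t"
  show "\<sigma> u < \<sigma> t"
  proof (rule DERIV_pos_imp_increasing_open [OF ut(3)])
    show "\<exists>d. (\<sigma> has_real_derivative d) (at v) \<and> 0 < d" if "u < v" "v < t" for v
      using \<sigma>_deriv [of v] speed_pos [of v] that ut by auto
    show "continuous_on {u..t} \<sigma>"
      by (rule continuous_on_subset [OF cont]) (use ut in auto)
  qed
qed

lemma \<sigma>_pos: "t > 0 \<Longrightarrow> \<sigma> t > 0"
  using strict_mono_onD [OF strict_mono_\<sigma>, of 0 t] by (simp add: \<sigma>_0)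

text \<open>
A chord is no longer than the arc: the left-hand side is the difference of the distances of
\<open>\<gamma>(t)\<^sup>r\<close> and \<open>\<gamma>(0)\<^sup>r\<close> from the origin. This gives \<open>\<sigma> \<longlongrightarrow> \<infinity>\<close> for all \<open>r > 0\<close> at once.
\<close>

lemma chord_le_length: "t \<ge> 0 \<Longrightarrow> q t powr (r / 2) - q 0 powr (r / 2) \<le> \<sigma> t"
proof -
  assume t: "t \<ge> 0"
  have "\<sigma> 0 - q 0 powr (r / 2) \<le> \<sigma> t - q t powr (r / 2)"
  proof (rule DERIV_nonneg_imp_increasing_open [OF t])
    fix u assume u: "0 < u" "u < t"
    have "\<bar>u + a\<bar> \<le> sqrt (q u)"
      by (rule real_le_rsqrt) (simp add: q_def)
    then have "u + a \<le> q u powr (1/2)"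
      using q_pos [OF u(1)] by (simp add: powr_half_sqrt)
    then have "q u powr (r / 2 - 1) * (u + a) \<le> q u powr (r / 2 - 1) * q u powr (1/2)"
      by (intro mult_left_mono) auto
    also have "\<dots> = q u powr ((r - 1) / 2)"
      by (simp add: field_simps flip: powr_add)
    finally have "0 \<le> r * (q u powr ((r - 1) / 2) - q u powr (r / 2 - 1) * (u + a))"
      using r by simp
    also have "\<dots> = speed u - r / 2 * q u powr (r / 2 - 1) * (2 * (u + a))"
      by (simp add: speed_def algebra_simps)
    finally have "0 \<le> speed u - r / 2 * q u powr (r / 2 - 1) * (2 * (u + a))" .
    moreover have "((\<lambda>u. \<sigma> u - q u powr (r / 2)) has_real_derivative
        speed u - r / 2 * q u powr (r / 2 - 1) * (2 * (u + a))) (at u)"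
      using q_pos [OF u(1)] by (auto intro!: derivative_eq_intros q_deriv \<sigma>_deriv u)
    ultimately show "\<exists>d. ((\<lambda>u. \<sigma> u - q u powr (r / 2)) has_real_derivative d) (at u) \<and> 0 \<le> d"
      by blast
  next
    have "continuous_on {0..t} (\<lambda>u. q u powr (r / 2))"
      using r unfolding q_def by (intro continuous_on_powr' continuous_intros) (auto simp: add_nonneg_nonneg)
    then show "continuous_on {0..t} (\<lambda>u. \<sigma> u - q u powr (r / 2))"
      by (intro continuous_on_diff continuous_on_subset [OF cont]) auto
  qed
  then show ?thesis
    by (simp add: \<sigma>_0)
qed

lemma filterlim_\<sigma>: "filterlim \<sigma> at_top at_top"
proof (rule filterlim_at_top_mono)
  show "filterlim (\<lambda>t. q t powr (r / 2) - q 0 powr (r / 2)) at_top at_top"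
    unfolding q_def using r by real_asymp
  show "\<forall>\<^sub>F t in at_top. q t powr (r / 2) - q 0 powr (r / 2) \<le> \<sigma> t"
    using eventually_ge_at_top [of 0] by eventually_elim (rule chord_le_length)
qed

lemma scale_bijection: "scale_bijection \<sigma> (the_inv_into {0..} \<sigma>)"
proof -
  have inj: "inj_on \<sigma> {0..}"
    by (rule strict_mono_on_imp_inj_on [OF strict_mono_\<sigma>])
  have nonneg: "\<sigma> t \<ge> 0" if "t \<ge> 0" for t
    using \<sigma>_pos [of t] \<sigma>_0 that by (cases "t = 0") auto
  have surj: "s \<in> \<sigma> ` {0..}" if s: "s \<ge> 0" for s
  proof -
    obtain M where M: "\<And>t. t \<ge> M \<Longrightarrow> s \<le> \<sigma> t"
      using filterlim_\<sigma> unfolding filterlim_at_top eventually_at_top_linorder by auto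
    have "\<exists>t\<ge>0. t \<le> max M 0 \<and> \<sigma> t = s"
      by (rule IVT') (use M s in \<open>auto simp: \<sigma>_0 intro: continuous_on_subset [OF cont]\<close>)
    then show ?thesis
      by auto
  qed
  show ?thesis
  proof
    show "the_inv_into {0..} \<sigma> s \<ge> 0" if "s \<ge> 0" for s
      using the_inv_into_into [OF inj surj [OF that], of "{0..}"] by simp
    show "\<sigma> (the_inv_into {0..} \<sigma> s) = s" if "s \<ge> 0" for s
      by (rule f_the_inv_into_f [OF inj surj [OF that]])
    show "the_inv_into {0..} \<sigma> (\<sigma> t) = t" if "t \<ge> 0" for t
      by (rule the_inv_into_f_f [OF inj]) (use that in simp)
  qed (use strict_mono_\<sigma> nonneg in auto)
qed

lemma x_deriv: "t > 0 \<Longrightarrow> (x has_real_derivative (x t + (-2) * (x t * (x t + y t))) / t) (at t)"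
proof -
  assume t: "t > 0"
  have "(x has_real_derivative (a * q t - a * t * (2 * (t + a))) / (q t * q t)) (at t)"
    unfolding x_def using q_pos [OF t] by (auto intro!: derivative_eq_intros q_deriv)
  moreover have "(a * q t - a * t * (2 * (t + a))) / (q t * q t) = (x t + (-2) * (x t * (x t + y t))) / t"
    using t q_pos [OF t] by (simp add: x_def y_def field_simps power2_eq_square)
  ultimately show ?thesis
    by (simp only:)
qed

lemma y_deriv: "t > 0 \<Longrightarrow> (y has_real_derivative (2 * y t + (-2) * (y t * (x t + y t))) / t) (at t)"
proof -
  assume t: "t > 0"
  have "(y has_real_derivative (2 * t * q t - t\<^sup>2 * (2 * (t + a))) / (q t * q t)) (at t)"
    unfolding y_def using q_pos [OF t] by (auto intro!: derivative_eq_intros q_deriv)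
  moreover have "(2 * t * q t - t\<^sup>2 * (2 * (t + a))) / (q t * q t) = (2 * y t + (-2) * (y t * (x t + y t))) / t"
    using t q_pos [OF t] by (simp add: x_def y_def field_simps power2_eq_square)
  ultimately show ?thesis
    by (simp only:)
qed

text \<open>
The limit of the elasticity \<open>\<kappa> = t \<sigma>' / \<sigma>\<close> is found by l'Hopital's rule, at infinity and at \<open>0\<close>
alike: the quotient of the derivatives is \<open>w = 1 + t \<sigma>'' / \<sigma>'\<close>.
\<close>

definition w :: "real \<Rightarrow> real" where "w t = 1 + (r - 1) * (x t + y t)"

lemma time_speed_deriv: "t > 0 \<Longrightarrow> ((\<lambda>t. t * speed t) has_real_derivative speed t * w t) (at t)"
  by (auto intro!: derivative_eq_intros speed_deriv simp: w_def field_simps)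

lemma \<kappa>_pos: "t > 0 \<Longrightarrow> \<kappa> t > 0"
  by (simp add: \<kappa>_def speed_pos \<sigma>_pos)

lemma \<kappa>_deriv: "t > 0 \<Longrightarrow> (\<kappa> has_real_derivative \<kappa> t * (w t + (-1) * \<kappa> t) / t) (at t)"
proof -
  assume t: "t > 0"
  have "(\<kappa> has_real_derivative (speed t * w t * \<sigma> t - t * speed t * speed t) / (\<sigma> t * \<sigma> t)) (at t)"
    unfolding \<kappa>_def using DERIV_divide [OF time_speed_deriv [OF t] \<sigma>_deriv [OF t]] \<sigma>_pos [OF t] by simp
  moreover have "(speed t * w t * \<sigma> t - t * speed t * speed t) / (\<sigma> t * \<sigma> t) = \<kappa> t * (w t + (-1) * \<kappa> t) / t"
    using t \<sigma>_pos [OF t] by (simp add: \<kappa>_def field_simps)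
  ultimately show ?thesis
    by (simp only:)
qed

lemma inverse_\<kappa>_deriv: "t > 0 \<Longrightarrow>
  ((\<lambda>t. 1 / \<kappa> t) has_real_derivative (1 / \<kappa> t * (\<kappa> t + (-1) * w t)) / t) (at t)"
proof -
  assume t: "t > 0"
  have "((\<lambda>t. 1 / \<kappa> t) has_real_derivative - (\<kappa> t * (w t + (-1) * \<kappa> t) / t) / (\<kappa> t * \<kappa> t)) (at t)"
    using DERIV_divide [OF DERIV_const \<kappa>_deriv [OF t], of 1] \<kappa>_pos [OF t] by simp
  moreover have "- (\<kappa> t * (w t + (-1) * \<kappa> t) / t) / (\<kappa> t * \<kappa> t) = (1 / \<kappa> t * (\<kappa> t + (-1) * w t)) / t"
    using t \<kappa>_pos [OF t] by (simp add: field_simps)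
  ultimately show ?thesis
    by (simp only:)
qed

lemma limits_at_top: "(x \<longlongrightarrow> 0) at_top" "(y \<longlongrightarrow> 1) at_top"
  unfolding x_def y_def q_def by real_asymp+

lemma origin_cases: obtains "a = 0" "b = 0" | "q 0 > 0"
  by (cases "a = 0 \<and> b = 0") (auto simp: q_def sum_power2_gt_zero_iff)

text \<open>
If the ray starts at the origin, then \<open>\<gamma>(t)\<^sup>r\<close> has length exactly \<open>t powr r\<close> and \<open>y = 1\<close>;
otherwise everything is continuous at \<open>0\<close> and \<open>y\<close> vanishes there. In both cases the limit
\<open>1 + (r - 1) c\<close> of \<open>w\<close> is positive, which keeps \<open>1 / \<kappa>\<close> bounded near \<open>0\<close>.
\<close>

lemma limits_at_0:
  obtains c where "(x \<longlongrightarrow> 0) (at_right 0)" "(y \<longlongrightarrow> c) (at_right 0)" "1 + (r - 1) * c > 0"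
    "((\<lambda>t. t * speed t) \<longlongrightarrow> 0) (at_right 0)"
proof (cases rule: origin_cases)
  case 1
  have "\<forall>\<^sub>F t in at_right 0. y t = 1"
    using eventually_at_right_less [of 0] unfolding y_def q_def by eventually_elim (simp add: 1)
  then have "(y \<longlongrightarrow> 1) (at_right 0)"
    by (rule tendsto_eventually)
  moreover have "((\<lambda>t. t * speed t) \<longlongrightarrow> 0) (at_right 0)"
    unfolding speed_def q_def unfolding 1 using r by real_asymp
  moreover have "(x \<longlongrightarrow> 0) (at_right 0)"
    unfolding x_def [abs_def] by (simp add: 1)
  ultimately show ?thesis
    using that [of 1] r by simp
next
  case 2
  have q: "(q \<longlongrightarrow> q 0) (at_right 0)"
    unfolding q_def by (auto intro!: tendsto_eq_intros)
  have "((\<lambda>t. a * t / q t) \<longlongrightarrow> a * 0 / q 0) (at_right 0)" "((\<lambda>t. t\<^sup>2 / q t) \<longlongrightarrow> 0\<^sup>2 / q 0) (at_right 0)"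
    using 2 by (intro tendsto_intros q; simp)+
  moreover have "((\<lambda>t. t * speed t) \<longlongrightarrow> 0 * (r * q 0 powr ((r - 1) / 2))) (at_right 0)"
    unfolding speed_def using 2 by (intro tendsto_intros q) auto
  ultimately show ?thesis
    using that [of 0] by (simp add: x_def [abs_def] y_def [abs_def])
qed

lemma \<kappa>_at_top: "(\<kappa> \<longlongrightarrow> r) at_top"
  unfolding \<kappa>_def
proof (rule lhospital_at_top_at_top [OF filterlim_\<sigma>])
  show "\<forall>\<^sub>F t in at_top. speed t \<noteq> 0"
    using eventually_gt_at_top [of 0] by eventually_elim (use speed_pos in force)
  show "\<forall>\<^sub>F t in at_top. ((\<lambda>t. t * speed t) has_real_derivative speed t * w t) (at t)"
    using eventually_gt_at_top [of 0] by eventually_elim (rule time_speed_deriv)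
  show "\<forall>\<^sub>F t in at_top. (\<sigma> has_real_derivative speed t) (at t)"
    using eventually_gt_at_top [of 0] by eventually_elim (rule \<sigma>_deriv)
  have "(w \<longlongrightarrow> 1 + (r - 1) * (0 + 1)) at_top"
    unfolding w_def by (intro tendsto_intros limits_at_top)
  moreover have "\<forall>\<^sub>F t in at_top. w t = speed t * w t / speed t"
    using eventually_gt_at_top [of 0] by eventually_elim (use speed_pos in force)
  ultimately show "((\<lambda>t. speed t * w t / speed t) \<longlongrightarrow> r) at_top"
    by (simp add: Lim_transform_eventually)
qed

lemma \<kappa>_at_0: obtains c where "(\<kappa> \<longlongrightarrow> c) (at_right 0)" "c > 0"
proof -
  obtain c where c: "(x \<longlongrightarrow> 0) (at_right 0)" "(y \<longlongrightarrow> c) (at_right 0)" "1 + (r - 1) * c > 0"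
    "((\<lambda>t. t * speed t) \<longlongrightarrow> 0) (at_right 0)"
    using limits_at_0 .
  have "(\<kappa> \<longlongrightarrow> 1 + (r - 1) * (0 + c)) (at_right 0)"
    unfolding \<kappa>_def
  proof (rule lhopital_right_0 [OF c(4)])
    have "(\<sigma> \<longlongrightarrow> \<sigma> 0) (at 0 within {0..})"
      using cont by (simp add: continuous_on)
    then show "(\<sigma> \<longlongrightarrow> 0) (at_right 0)"
      using tendsto_within_subset [where T = "{0<..}"] by (fastforce simp: \<sigma>_0)
    show "\<forall>\<^sub>F t in at_right 0. \<sigma> t \<noteq> 0"
      using eventually_at_right_less [of 0] by eventually_elim (use \<sigma>_pos in force)
    show "\<forall>\<^sub>F t in at_right 0. speed t \<noteq> 0"
      using eventually_at_right_less [of 0] by eventually_elim (use speed_pos in force)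
    show "\<forall>\<^sub>F t in at_right 0. ((\<lambda>t. t * speed t) has_real_derivative speed t * w t) (at t)"
      using eventually_at_right_less [of 0] by eventually_elim (rule time_speed_deriv)
    show "\<forall>\<^sub>F t in at_right 0. (\<sigma> has_real_derivative speed t) (at t)"
      using eventually_at_right_less [of 0] by eventually_elim (rule \<sigma>_deriv)
    have "(w \<longlongrightarrow> 1 + (r - 1) * (0 + c)) (at_right 0)"
      unfolding w_def by (intro tendsto_intros c)
    moreover have "\<forall>\<^sub>F t in at_right 0. w t = speed t * w t / speed t"
      using eventually_at_right_less [of 0] by eventually_elim (use speed_pos in force)
    ultimately show "((\<lambda>t. speed t * w t / speed t) \<longlongrightarrow> 1 + (r - 1) * (0 + c)) (at_right 0)"
      by (rule Lim_transform_eventually)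
  qed
  then show ?thesis
    using that c(3) by simp
qed

text \<open>
Closed under the Euler operator up to polynomials:
\<open>D \<kappa> = \<kappa> (w - \<kappa>)\<close> and \<open>D (1 / \<kappa>) = (1 / \<kappa>) (\<kappa> - w)\<close>, where \<open>w\<close> is a polynomial in \<open>x\<close> and \<open>y\<close>.
\<close>

definition generators :: "(real \<Rightarrow> real) set" where
  "generators = {x, y, \<kappa>, \<lambda>t. 1 / \<kappa> t}"

lemma slow_algebra: "slow_algebra (generated_algebra generators)" (is "slow_algebra ?A")
proof (rule slow_algebra_generated)
  have gen: "x \<in> ?A" "y \<in> ?A" "\<kappa> \<in> ?A" "(\<lambda>t. 1 / \<kappa> t) \<in> ?A"
    by (auto intro!: generated_algebra.generator simp: generators_def)
  have w: "w \<in> ?A"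
    unfolding w_def by (intro generated_algebra.add generated_algebra.mult generated_algebra.const gen)
  have derivs:
    "\<exists>\<psi>'\<in>?A. \<forall>t>0. (x has_real_derivative \<psi>' t / t) (at t)"
    "\<exists>\<psi>'\<in>?A. \<forall>t>0. (y has_real_derivative \<psi>' t / t) (at t)"
    "\<exists>\<psi>'\<in>?A. \<forall>t>0. (\<kappa> has_real_derivative \<psi>' t / t) (at t)"
    "\<exists>\<psi>'\<in>?A. \<forall>t>0. ((\<lambda>t. 1 / \<kappa> t) has_real_derivative \<psi>' t / t) (at t)"
    by (rule bexI, intro allI impI, erule x_deriv y_deriv \<kappa>_deriv inverse_\<kappa>_deriv,
        intro generated_algebra.add generated_algebra.mult generated_algebra.const gen w)+
  then show deriv: "\<exists>\<psi>'\<in>?A. \<forall>t>0. (\<psi> has_real_derivative \<psi>' t / t) (at t)" if "\<psi> \<in> generators" for \<psi>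
    using that unfolding generators_def by blast
  have inv_lim: "((\<lambda>t. 1 / \<kappa> t) \<longlongrightarrow> 1 / r) at_top"
    using r by (intro tendsto_intros \<kappa>_at_top) auto
  then show lim: "\<exists>c. (\<psi> \<longlongrightarrow> c) at_top" if "\<psi> \<in> generators" for \<psi>
    using that limits_at_top \<kappa>_at_top unfolding generators_def by auto
  have lim0: "\<exists>c. (\<psi> \<longlongrightarrow> c) (at_right 0)" if "\<psi> \<in> generators" for \<psi>
  proof -
    obtain c where c: "(\<kappa> \<longlongrightarrow> c) (at_right 0)" "c > 0"
      using \<kappa>_at_0 .
    then have "((\<lambda>t. 1 / \<kappa> t) \<longlongrightarrow> 1 / c) (at_right 0)"
      by (intro tendsto_intros) auto
    with that c(1) limits_at_0 show ?thesis
      unfolding generators_def by (metis insert_iff empty_iff)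
  qed
  have cont: "continuous_on {0<..} \<psi>" if \<psi>: "\<psi> \<in> generators" for \<psi>
  proof -
    obtain \<psi>' where "\<forall>t>0. (\<psi> has_real_derivative \<psi>' t / t) (at t)"
      using deriv [OF \<psi>] by auto
    then show ?thesis
      by (meson DERIV_isCont continuous_at_imp_continuous_on greaterThan_iff)
  qed
  show "bounded (\<psi> ` {0<..})" if \<psi>: "\<psi> \<in> generators" for \<psi>
  proof -
    obtain c d where "(\<psi> \<longlongrightarrow> c) (at_right 0)" "(\<psi> \<longlongrightarrow> d) at_top"
      using lim [OF \<psi>] lim0 [OF \<psi>] by auto
    then show ?thesis
      by (rule bounded_on_half_line [OF cont [OF \<psi>]])
  qed
qed

lemma change_of_scale_both_ways:
  "change_of_scale \<sigma> (the_inv_into {0..} \<sigma>)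
     ((\<lambda>\<psi> s. \<psi> (the_inv_into {0..} \<sigma> s)) ` generated_algebra generators) (\<lambda>s. \<kappa> (the_inv_into {0..} \<sigma> s))"
  "change_of_scale (the_inv_into {0..} \<sigma>) \<sigma> (generated_algebra generators) (\<lambda>t. 1 / \<kappa> t)"
proof -
  have gen: "\<kappa> \<in> generated_algebra generators" "(\<lambda>t. 1 / \<kappa> t) \<in> generated_algebra generators"
    by (auto intro!: generated_algebra.generator simp: generators_def)
  have elasticity: "(\<sigma> has_real_derivative \<kappa> t * \<sigma> t / t) (at t)" if "t > 0" for t
  proof -
    have "\<kappa> t * \<sigma> t / t = speed t"
      using that \<sigma>_pos [OF that] by (simp add: \<kappa>_def)
    then show ?thesis
      using \<sigma>_deriv [OF that] by (simp only:)
  qed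
  note both = scale_bijection.change_of_scale_both_ways [OF scale_bijection slow_algebra gen \<kappa>_pos elasticity]
  show "change_of_scale \<sigma> (the_inv_into {0..} \<sigma>)
     ((\<lambda>\<psi> s. \<psi> (the_inv_into {0..} \<sigma> s)) ` generated_algebra generators) (\<lambda>s. \<kappa> (the_inv_into {0..} \<sigma> s))"
    by (rule both(1))
  show "change_of_scale (the_inv_into {0..} \<sigma>) \<sigma> (generated_algebra generators) (\<lambda>t. 1 / \<kappa> t)"
    by (rule both(2))
qed

end

section \<open>Powers of rays and transfer of limits\<close>

lemma has_vector_derivative_transform_eventually:
  assumes "(f has_vector_derivative d) (at t)" "\<forall>\<^sub>F u in at t. f u = g u" "f t = g t"
  shows "(g has_vector_derivative d) (at t)"
  using assms unfolding has_vector_derivative_def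
  by (rule has_derivative_transform_eventually) simp

text \<open>
A branch is only assumed continuous. Near \<open>t\<close> it differs from its value there by less than \<open>\<pi>\<close> in
imaginary part, so it agrees with the principal logarithm of \<open>\<gamma> u / \<gamma> t\<close> plus a constant.
\<close>

lemma log_branch_has_vector_derivative:
  assumes l: "log_branch \<gamma> l" and \<gamma>: "\<And>t. t > 0 \<Longrightarrow> \<gamma> t \<noteq> 0"
    and deriv: "(\<gamma> has_vector_derivative d) (at t)" and t: "t > 0"
  shows "(l has_vector_derivative d / \<gamma> t) (at t)"
proof -
  have exp_l: "exp (l u) = \<gamma> u" if "u > 0" for u
    using l \<gamma> [OF that] that by (simp add: log_branch_def)
  have "continuous_on {0<..} l"
    by (rule continuous_on_subset [of "{t. 0 \<le> t \<and> \<gamma> t \<noteq> 0}"])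
       (use l \<gamma> in \<open>auto simp: log_branch_def\<close>)
  then have "isCont l t"
    using t by (simp add: continuous_on_eq_continuous_at)
  then have "((\<lambda>u. Im (l u - l t)) \<longlongrightarrow> Im (l t - l t)) (at t)"
    by (intro tendsto_intros) (simp add: isCont_def)
  then have "((\<lambda>u. Im (l u - l t)) \<longlongrightarrow> 0) (at t)"
    by simp
  then have "\<forall>\<^sub>F u in at t. \<bar>Im (l u - l t)\<bar> < pi"
    using tendstoD [of "\<lambda>u. Im (l u - l t)" 0 "at t" pi] pi_gt_zero by (simp add: dist_real_def)
  moreover have "\<forall>\<^sub>F u in at t. u > 0"
    by (rule order_tendstoD(1) [OF tendsto_ident_at t])
  ultimately have ev: "\<forall>\<^sub>F u in at t. Ln (\<gamma> u / \<gamma> t) + l t = l u"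
  proof eventually_elim
    case (elim u)
    have "\<gamma> u / \<gamma> t = exp (l u - l t)"
      using exp_l [OF elim(2)] exp_l [OF t] by (simp add: exp_diff)
    then show ?case
      using elim(1) by (simp add: abs_less_iff Ln_exp)
  qed
  have nz: "\<gamma> t \<noteq> 0"
    by (rule \<gamma> [OF t])
  have "((\<lambda>u. \<gamma> u / \<gamma> t) has_vector_derivative d / \<gamma> t) (at t)"
    using has_vector_derivative_divide [OF deriv] .
  moreover have "(Ln has_field_derivative 1) (at (\<gamma> t / \<gamma> t))"
    using has_field_derivative_Ln [of 1] nz by simp
  ultimately have "((\<lambda>u. Ln (\<gamma> u / \<gamma> t)) has_vector_derivative d / \<gamma> t * 1) (at t)"
    using field_vector_diff_chain_at [of "\<lambda>u. \<gamma> u / \<gamma> t" "d / \<gamma> t" t Ln 1] by (simp add: o_def)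
  then have "((\<lambda>u. Ln (\<gamma> u / \<gamma> t) + l t) has_vector_derivative d / \<gamma> t) (at t)"
    by (auto intro!: derivative_eq_intros)
  then show ?thesis
    by (rule has_vector_derivative_transform_eventually [OF _ ev]) (use nz in simp)
qed

lemma norm_vector_derivative_powered_curve:
  assumes l: "log_branch \<gamma> l" and \<gamma>: "\<And>t. t > 0 \<Longrightarrow> \<gamma> t \<noteq> 0" and r: "r > 0"
    and deriv: "(\<gamma> has_vector_derivative d) (at t)" "norm d = 1" and t: "t > 0"
  shows "norm (vector_derivative (powered_curve \<gamma> l r) (at t)) = r * norm (\<gamma> t) powr (r - 1)"
proof -
  have "((\<lambda>u. of_real r * l u) has_vector_derivative of_real r * (d / \<gamma> t)) (at t)"
    by (intro has_vector_derivative_mult_right log_branch_has_vector_derivative [OF l \<gamma> deriv(1) t])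
  then have "((\<lambda>u. exp (of_real r * l u)) has_vector_derivative
      of_real r * (d / \<gamma> t) * exp (of_real r * l t)) (at t)"
    using field_vector_diff_chain_at [of "\<lambda>u. of_real r * l u" _ t exp] DERIV_exp by (fastforce simp: o_def)
  moreover have "\<forall>\<^sub>F u in at t. exp (of_real r * l u) = powered_curve \<gamma> l r u"
    using order_tendstoD(1) [OF tendsto_ident_at t]
    by eventually_elim (simp add: powered_curve_def \<gamma>)
  ultimately have "(powered_curve \<gamma> l r has_vector_derivative
      of_real r * (d / \<gamma> t) * exp (of_real r * l t)) (at t)"
    by (rule has_vector_derivative_transform_eventually) (simp add: powered_curve_def \<gamma> t)
  then have "vector_derivative (powered_curve \<gamma> l r) (at t) = of_real r * (d / \<gamma> t) * exp (of_real r * l t)"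
    by (rule vector_derivative_at)
  moreover have "exp (Re (l t)) = norm (\<gamma> t)"
    using l \<gamma> [OF t] t norm_exp_eq_Re [of "l t"] by (simp add: log_branch_def)
  then have "exp (r * Re (l t)) = norm (\<gamma> t) powr r"
    using exp_powr_real [of "Re (l t)" r] by (simp add: mult.commute)
  then have "norm (exp (of_real r * l t)) = norm (\<gamma> t) powr r"
    by (simp add: norm_exp_eq_Re)
  ultimately show ?thesis
    using r deriv(2) \<gamma> [OF t] by (simp add: norm_mult norm_divide powr_diff)
qed

text \<open>
The integrand can be singular at \<open>0\<close> only if the ray starts at the origin, and then \<open>u powr r\<close> is
an explicit primitive.
\<close>

lemma ray_length_integral:
  fixes a b r :: real
  defines "v \<equiv> \<lambda>u. r * ((u + a)\<^sup>2 + b\<^sup>2) powr ((r - 1) / 2)"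
  assumes r: "r > 0" and pos: "\<And>t. t > 0 \<Longrightarrow> (t + a)\<^sup>2 + b\<^sup>2 > 0"
  shows "ray_length a b r (\<lambda>t. integral {0..t} v)"
proof -
  have int: "v integrable_on {0..T}" if "T \<ge> 0" for T
  proof (cases "a = 0 \<and> b = 0")
    case True
    have "((\<lambda>u. u powr r) has_vector_derivative v u) (at u)" if "u \<in> {0<..<T}" for u
    proof -
      have "(u\<^sup>2) powr ((r - 1) / 2) = (u powr 2) powr ((r - 1) / 2)"
        using that by simp
      also have "\<dots> = u powr (r - 1)"
        unfolding powr_powr by (rule arg_cong [of _ _ "(powr) u"]) simp
      finally have "v u = r * u powr (r - 1)"
        using True by (simp add: v_def)
      then show ?thesis
        using that by (auto intro!: derivative_eq_intros simp flip: has_real_derivative_iff_has_vector_derivative)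
    qed
    moreover have "continuous_on {0..T} (\<lambda>u. u powr r)"
      using r by (intro continuous_on_powr' continuous_intros) auto
    ultimately show ?thesis
      using fundamental_theorem_of_calculus_interior [OF that] by (meson has_integral_integrable)
  next
    case False
    have "(u + a)\<^sup>2 + b\<^sup>2 \<noteq> 0" if "u \<ge> 0" for u
      using pos [of u] False that by (cases "u = 0") (auto simp: sum_power2_eq_zero_iff)
    then have "continuous_on {0..T} v"
      unfolding v_def by (intro continuous_intros) auto
    then show ?thesis
      by (rule integrable_continuous_interval)
  qed
  have v_cont: "isCont v t" if "t > 0" for t
    unfolding v_def using pos [OF that] by (intro continuous_intros) auto
  show ?thesis
  proof
    show "((\<lambda>t. integral {0..t} v) has_real_derivative r * ((t + a)\<^sup>2 + b\<^sup>2) powr ((r - 1) / 2)) (at t)"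
      if "t > 0" for t
    proof -
      have "((\<lambda>t. integral {0..t} v) has_vector_derivative v t) (at t within {0..t+1} - {})"
        using that int [of "t + 1"] v_cont [OF that]
        by (intro integral_has_vector_derivative_continuous_at) (auto intro: continuous_at_imp_continuous_at_within)
      then have "((\<lambda>t. integral {0..t} v) has_vector_derivative v t) (at t)"
        using that by (simp add: at_within_Icc_at)
      then show ?thesis
        by (simp add: has_real_derivative_iff_has_vector_derivative v_def)
    qed
    show "continuous_on {0..} (\<lambda>t. integral {0..t} v)"
      unfolding continuous_on_def
    proof
      fix t :: real assume t: "t \<in> {0..}"
      have "((\<lambda>t. integral {0..t} v) \<longlongrightarrow> integral {0..t} v) (at t within {0..t+1})"
        using t indefinite_integral_continuous_1 [OF int [of "t + 1"]] by (simp add: continuous_on_def)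
      moreover have "at t within {0..t+1} = at t within {0..}"
        by (rule at_within_nhd [of _ "{..<t+1}"]) auto
      ultimately show "((\<lambda>t. integral {0..t} v) \<longlongrightarrow> integral {0..t} v) (at t within {0..})"
        by simp
    qed
  qed (use r pos in auto)
qed

lemma ray_length_power_length:
  assumes r: "r > 0" and ray: "ray_contour \<gamma>" and l: "log_branch \<gamma> l"
  obtains a b where "ray_length a b r (power_length \<gamma> l r)"
proof -
  obtain z\<^sub>0 d where d: "d \<in> {1, -1, \<i>, -\<i>}" and \<gamma>: "\<And>t. t \<ge> 0 \<Longrightarrow> \<gamma> t = z\<^sub>0 + complex_of_real t * d"
    and nz: "\<And>t. t > 0 \<Longrightarrow> \<gamma> t \<noteq> 0"
    using ray unfolding ray_contour_def by blast
  have norm_d: "norm d = 1"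
    using d by auto
  define a b where "a = Re (z\<^sub>0 * cnj d)" and "b = Im (z\<^sub>0 * cnj d)"
  have norm_\<gamma>: "(norm (\<gamma> t))\<^sup>2 = (t + a)\<^sup>2 + b\<^sup>2" if "t \<ge> 0" for t
  proof -
    have "d * cnj d = 1"
      using norm_d by (simp add: complex_norm_square [symmetric])
    then have "\<gamma> t * cnj d = z\<^sub>0 * cnj d + of_real t"
      by (simp add: \<gamma> [OF that] algebra_simps)
    then have "norm (\<gamma> t) = norm (z\<^sub>0 * cnj d + of_real t)"
      using norm_d by (metis complex_mod_cnj mult.right_neutral norm_mult)
    then show ?thesis
      by (simp add: cmod_power2 a_def b_def add.commute)
  qed
  have pos: "(t + a)\<^sup>2 + b\<^sup>2 > 0" if "t > 0" for t
    using nz [OF that] norm_\<gamma> [of t] that by (metis less_imp_le zero_less_norm_iff zero_less_power)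
  have speed: "norm (vector_derivative (powered_curve \<gamma> l r) (at t)) = r * ((t + a)\<^sup>2 + b\<^sup>2) powr ((r - 1) / 2)"
    if t: "t > 0" for t
  proof -
    have "((\<lambda>t. z\<^sub>0 + complex_of_real t * d) has_vector_derivative d) (at t)"
      by (auto intro!: derivative_eq_intros)
    moreover have "\<forall>\<^sub>F u in at t. z\<^sub>0 + complex_of_real u * d = \<gamma> u"
      using order_tendstoD(1) [OF tendsto_ident_at t] by eventually_elim (simp add: \<gamma>)
    ultimately have "(\<gamma> has_vector_derivative d) (at t)"
      by (rule has_vector_derivative_transform_eventually) (use t in \<open>simp add: \<gamma>\<close>)
    then have "norm (vector_derivative (powered_curve \<gamma> l r) (at t)) = r * norm (\<gamma> t) powr (r - 1)"
      using l nz r norm_d t by (intro norm_vector_derivative_powered_curve) auto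
    also have "norm (\<gamma> t) = ((t + a)\<^sup>2 + b\<^sup>2) powr (1 / 2)"
      using t norm_\<gamma> [of t] by (simp add: powr_half_sqrt flip: norm_\<gamma>)
    finally show ?thesis
      by (simp add: powr_powr)
  qed
  have "power_length \<gamma> l r = (\<lambda>t. integral {0..t} (\<lambda>u. r * ((u + a)\<^sup>2 + b\<^sup>2) powr ((r - 1) / 2)))"
  proof
    fix t
    show "power_length \<gamma> l r t = integral {0..t} (\<lambda>u. r * ((u + a)\<^sup>2 + b\<^sup>2) powr ((r - 1) / 2))"
      unfolding power_length_def arc_length_def
      by (rule integral_spike [of "{0}"]) (use speed in auto)
  qed
  then show ?thesis
    using that ray_length_integral [OF r pos] by simp
qed

text \<open>
A decomposition along one curve becomes one along the other: when the logarithms are proportional,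
each term \<open>\<gamma>\<^sub>1^\<rho> (ln \<gamma>\<^sub>1)^m\<close> is a constant multiple of the term with exponents \<open>\<rho> / c\<close> and \<open>m\<close> along
\<open>\<gamma>\<^sub>2\<close>. So only the remainder has to be compared, and \<open>T\<close> may be either change of parameter.
\<close>

lemma has_gen_cesaro_limit_transfer:
  assumes T: "\<And>s. s \<ge> 0 \<Longrightarrow> T s \<ge> 0" and c: "c > 0"
    and nz: "\<And>s. s \<ge> 0 \<Longrightarrow> \<gamma>\<^sub>2 s \<noteq> 0 \<Longrightarrow> \<gamma>\<^sub>1 (T s) \<noteq> 0"
    and log: "\<And>s. s \<ge> 0 \<Longrightarrow> l\<^sub>2 s = of_real c * l\<^sub>1 (T s)"
    and f: "\<And>s. s \<ge> 0 \<Longrightarrow> f\<^sub>2 s = f\<^sub>1 (T s)"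
    and adm: "\<And>R. admissible_remainder R \<Longrightarrow> admissible_remainder (\<lambda>s. R (T s))"
    and avg: "\<And>R N. admissible_remainder R \<Longrightarrow> ((average ^^ N) R \<longlongrightarrow> L) at_top \<Longrightarrow>
                ((average ^^ N) (\<lambda>s. R (T s)) \<longlongrightarrow> L) at_top"
    and lim: "has_gen_cesaro_limit \<gamma>\<^sub>1 l\<^sub>1 f\<^sub>1 L"
  shows "has_gen_cesaro_limit \<gamma>\<^sub>2 l\<^sub>2 f\<^sub>2 L"
proof -
  obtain n :: nat and a \<rho> :: "nat \<Rightarrow> complex" and m :: "nat \<Rightarrow> nat" and R N
    where \<rho>: "\<forall>j\<in>{1..n}. \<rho> j \<noteq> 0" and R: "admissible_remainder R"
      and decomp: "\<forall>t\<ge>0. \<gamma>\<^sub>1 t \<noteq> 0 \<longrightarrow> f\<^sub>1 t = (\<Sum>j=1..n. a j * exp (\<rho> j * l\<^sub>1 t) * l\<^sub>1 t ^ m j) + R t"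
      and N: "((average ^^ N) R \<longlongrightarrow> L) at_top"
    using lim unfolding has_gen_cesaro_limit_def by blast
  define a' where "a' j = a j / of_real c ^ m j" for j
  define \<rho>' where "\<rho>' j = \<rho> j / of_real c" for j
  have term_eq: "a' j * exp (\<rho>' j * (of_real c * z)) * (of_real c * z) ^ m j = a j * exp (\<rho> j * z) * z ^ m j"
    for j z
    using c by (simp add: a'_def \<rho>'_def power_mult_distrib)
  have "\<forall>s\<ge>0. \<gamma>\<^sub>2 s \<noteq> 0 \<longrightarrow>
      f\<^sub>2 s = (\<Sum>j=1..n. a' j * exp (\<rho>' j * l\<^sub>2 s) * l\<^sub>2 s ^ m j) + R (T s)"
    using decomp T nz by (simp add: log f term_eq)
  moreover have "\<forall>j\<in>{1..n}. \<rho>' j \<noteq> 0"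
    using \<rho> c by (simp add: \<rho>'_def)
  ultimately show ?thesis
    unfolding has_gen_cesaro_limit_def using adm [OF R] avg [OF R N] by blast
qed

theorem theorem2:
  fixes \<gamma> l f g :: "real \<Rightarrow> complex" and r :: real
  assumes "r > 0"
    and "ray_contour \<gamma>"
    and "log_branch \<gamma> l"
    and "\<And>t. t \<ge> 0 \<Longrightarrow> g t = f (power_length \<gamma> l r t)"
  shows "((\<exists>L. has_gen_cesaro_limit \<gamma> l g L) \<longleftrightarrow>
          (\<exists>L. has_gen_cesaro_limit (power_contour \<gamma> l r) (power_log \<gamma> l r) f L)) \<and>
         (\<forall>L. has_gen_cesaro_limit \<gamma> l g L \<longleftrightarrow>
              has_gen_cesaro_limit (power_contour \<gamma> l r) (power_log \<gamma> l r) f L)"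
proof -
  obtain a b where len: "ray_length a b r (power_length \<gamma> l r)"
    using ray_length_power_length [OF assms(1-3)] .
  let ?\<sigma> = "power_length \<gamma> l r" and ?\<tau> = "power_param \<gamma> l r"
  interpret ray_length a b r ?\<sigma>
    by (rule len)
  note to_power = change_of_scale.iterated_average_compose [OF change_of_scale_both_ways(1)]
      change_of_scale.admissible_compose [OF change_of_scale_both_ways(1)]
    and from_power = change_of_scale.iterated_average_compose [OF change_of_scale_both_ways(2)]
      change_of_scale.admissible_compose [OF change_of_scale_both_ways(2)]
  have bij: "scale_bijection ?\<sigma> ?\<tau>"
    unfolding power_param_def by (rule scale_bijection)
  note nonneg = scale_bijection.\<sigma>_nonneg [OF bij] scale_bijection.\<tau>_nonneg [OF bij]
    and inverse = scale_bijection.\<sigma>_\<tau> [OF bij] scale_bijection.\<tau>_\<sigma> [OF bij]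
  have "has_gen_cesaro_limit \<gamma> l g L \<longleftrightarrow>
        has_gen_cesaro_limit (power_contour \<gamma> l r) (power_log \<gamma> l r) f L" for L
  proof
    assume "has_gen_cesaro_limit \<gamma> l g L"
    then show "has_gen_cesaro_limit (power_contour \<gamma> l r) (power_log \<gamma> l r) f L"
    proof (rule has_gen_cesaro_limit_transfer [where T = ?\<tau> and c = r, rotated -1])
      show "power_contour \<gamma> l r s \<noteq> 0 \<Longrightarrow> \<gamma> (?\<tau> s) \<noteq> 0" for s
        by (auto simp: power_contour_def powered_curve_def)
      show "f s = g (?\<tau> s)" if "s \<ge> 0" for s
        by (simp add: assms(4) nonneg inverse that)
    qed (use nonneg to_power assms(1) in \<open>simp_all add: power_log_def power_param_def\<close>)
  next
    assume "has_gen_cesaro_limit (power_contour \<gamma> l r) (power_log \<gamma> l r) f L"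
    then show "has_gen_cesaro_limit \<gamma> l g L"
    proof (rule has_gen_cesaro_limit_transfer [where T = ?\<sigma> and c = "1 / r", rotated -1])
      show "power_contour \<gamma> l r (?\<sigma> t) \<noteq> 0" if "t \<ge> 0" "\<gamma> t \<noteq> 0" for t
        using that by (simp add: power_contour_def powered_curve_def inverse)
      show "l t = of_real (1 / r) * power_log \<gamma> l r (?\<sigma> t)" if "t \<ge> 0" for t
        using that assms(1) by (simp add: power_log_def inverse)
    qed (use nonneg from_power assms(1,4) in simp_all)
  qed
  then show ?thesis
    by simp
qed

end
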